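(* Let $X$ be a locally compact Hausdorff space. (A) The following are equivalent: (1) $\mathbf{M}(X)$ is nowhere dense in $\mathbf{DTM}(X)$. (2) There exists a finite deficient topological measure on $X$ that is not a measure. (3) There exists a nonzero finite proper deficient topological measure on $X$. (B) The following are equivalent: (1) $\mathbf{M}(X)$ is nowhere dense in $\mathbf{TM}(X)$. (2) There exists a finite topological measure on $X$ that is not a measure. (3) There exists a nonzero finite proper topological measure on $X$.
   Context: $\mathcal{O}(X)$, $\mathcal{C}(X)$, $\mathcal{K}(X)$ are the collections of open, closed, compact subsets of $X$. A deficient topological measure on $X$ is a set function $\nu:\mathcal{C}(X)\cup\mathcal{O}(X)\to[0,\infty]$, not identically $\infty$, such that: (DTM1) $\nu(C\sqcup K)=\nu(C)+\nu(K)$ for disjoint $C,K\in\mathcal{K}(X)$; (DTM2) $\nu(U)=\sup\{\nu(C): C\subseteq U,\ C\in\mathcal{K}(X)\}$ for $U\in\mathcal{O}(X)$; (DTM3) $\nu(F)=\inf\{\nu(U): F\subseteq U,\ U\in\mathcal{O}(X)\}$ for $F\in\mathcal{C}(X)$. A topological measure is a set function $\mu:\mathcal{C}(X)\cup\mathcal{O}(X)\to[0,\infty]$, not identically $\infty$, satisfying (DTM2), (DTM3) and: if $A,B,A\sqcup B\in\mathcal{K}(X)\cup\mathcal{O}(X)$ (disjoint union) then $\mu(A\sqcup B)=\mu(A)+\mu(B)$. $\mathbf{DTM}(X)$, $\mathbf{TM}(X)$ are the sets of finite ($\mu(X)<\infty$) deficient topological measures and finite topological measures. $\mathbf{M}(X)$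 is the set of restrictions to $\mathcal{O}(X)\cup\mathcal{C}(X)$ of finite Borel measures on $X$ that are inner regular (by compact sets) on open sets and outer regular (by open sets) on all Borel sets; $\mathbf{M}(X)\subseteq\mathbf{TM}(X)\subseteq\mathbf{DTM}(X)$. A finite deficient topological measure "is a measure" if it belongs to $\mathbf{M}(X)$. A deficient topological measure $\nu$ is proper if $m\le\nu$ (on $\mathcal{O}(X)\cup\mathcal{C}(X)$) with $m$ a Radon measure implies $m=0$; here a Radon measure is a Borel measure finite on compact sets, outer regular on all Borel sets and inner regular (by compact sets) on open sets. $\mathbf{DTM}(X)$ carries the weak topology (and $\mathbf{TM}(X)$ its subspace topology): the coarsest topology making $\mu\mapsto\int_X f\,d\mu$ continuous for every $f\in C_0^+(X)$ (nonnegative continuous functions vanishing at infinity), where $\int_X f\,d\mu=\int_0^b\mu(f^{-1}((t,\infty)))\,dt$ if $f(X)\subseteq[0,b]$. *)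

theory Defs
  imports "HOL-Analysis.Analysis"
begin

definition open_or_closed :: "'a topology \<Rightarrow> 'a set set" where
  "open_or_closed X = {A. openin X A \<or> closedin X A}"

(* Set functions on O(X) \<union> C(X) are represented as total functions on sets that are extensional
   (i.e. equal to undefined) outside O(X) \<union> C(X), so that equal set functions are equal as
   HOL functions. *)

definition deficient_topological_measure :: "'a topology \<Rightarrow> ('a set \<Rightarrow> ennreal) \<Rightarrow> bool" where
  "deficient_topological_measure X \<nu> \<longleftrightarrow>
     \<nu> \<in> extensional (open_or_closed X) \<and>
     (\<exists>A \<in> open_or_closed X. \<nu> A \<noteq> \<infinity>) \<and>
     (\<forall>C K. compactin X C \<and> compactin X K \<and> C \<inter> K = {} \<longrightarrow> \<nu> (C \<union> K) = \<nu> C + \<nu> K) \<and>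
     (\<forall>U. openin X U \<longrightarrow> \<nu> U = (SUP C \<in> {C. compactin X C \<and> C \<subseteq> U}. \<nu> C)) \<and>
     (\<forall>F. closedin X F \<longrightarrow> \<nu> F = (INF U \<in> {U. openin X U \<and> F \<subseteq> U}. \<nu> U))"

definition topological_measure :: "'a topology \<Rightarrow> ('a set \<Rightarrow> ennreal) \<Rightarrow> bool" where
  "topological_measure X \<mu> \<longleftrightarrow>
     \<mu> \<in> extensional (open_or_closed X) \<and>
     (\<exists>A \<in> open_or_closed X. \<mu> A \<noteq> \<infinity>) \<and>
     (\<forall>A B. (compactin X A \<or> openin X A) \<and> (compactin X B \<or> openin X B) \<and>
        (compactin X (A \<union> B) \<or> openin X (A \<union> B)) \<and> A \<inter> B = {} \<longrightarrow> \<mu> (A \<union> B) = \<mu> A + \<mu> B) \<and>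
     (\<forall>U. openin X U \<longrightarrow> \<mu> U = (SUP C \<in> {C. compactin X C \<and> C \<subseteq> U}. \<mu> C)) \<and>
     (\<forall>F. closedin X F \<longrightarrow> \<mu> F = (INF U \<in> {U. openin X U \<and> F \<subseteq> U}. \<mu> U))"

definition DTM :: "'a topology \<Rightarrow> ('a set \<Rightarrow> ennreal) set" where
  "DTM X = {\<nu>. deficient_topological_measure X \<nu> \<and> \<nu> (topspace X) < \<infinity>}"

definition TM :: "'a topology \<Rightarrow> ('a set \<Rightarrow> ennreal) set" where
  "TM X = {\<mu>. topological_measure X \<mu> \<and> \<mu> (topspace X) < \<infinity>}"

definition borel_measure_on :: "'a topology \<Rightarrow> 'a measure \<Rightarrow> bool" where
  "borel_measure_on X m \<longleftrightarrow>
     space m = topspace X \<and> sets m = sigma_sets (topspace X) {U. openin X U}"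

definition regular_borel_measure_on :: "'a topology \<Rightarrow> 'a measure \<Rightarrow> bool" where
  "regular_borel_measure_on X m \<longleftrightarrow>
     borel_measure_on X m \<and>
     (\<forall>A \<in> sets m. emeasure m A = (INF U \<in> {U. openin X U \<and> A \<subseteq> U}. emeasure m U)) \<and>
     (\<forall>U. openin X U \<longrightarrow> emeasure m U = (SUP C \<in> {C. compactin X C \<and> C \<subseteq> U}. emeasure m C))"

definition radon_measure_on :: "'a topology \<Rightarrow> 'a measure \<Rightarrow> bool" where
  "radon_measure_on X m \<longleftrightarrow>
     regular_borel_measure_on X m \<and> (\<forall>K. compactin X K \<longrightarrow> emeasure m K < \<infinity>)"

definition Meas :: "'a topology \<Rightarrow> ('a set \<Rightarrow> ennreal) set" where
  "Meas X = {restrict (emeasure m) (open_or_closed X) | m.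
     regular_borel_measure_on X m \<and> finite_measure m}"

definition proper :: "'a topology \<Rightarrow> ('a set \<Rightarrow> ennreal) \<Rightarrow> bool" where
  "proper X \<nu> \<longleftrightarrow>
     (\<forall>m. radon_measure_on X m \<and> (\<forall>A \<in> open_or_closed X. emeasure m A \<le> \<nu> A) \<longrightarrow>
        (\<forall>A \<in> sets m. emeasure m A = 0))"

definition nonzero :: "'a topology \<Rightarrow> ('a set \<Rightarrow> ennreal) \<Rightarrow> bool" where
  "nonzero X \<nu> \<longleftrightarrow> (\<exists>A \<in> open_or_closed X. \<nu> A \<noteq> 0)"

definition C0_plus :: "'a topology \<Rightarrow> ('a \<Rightarrow> real) set" where
  "C0_plus X = {f. continuous_map X euclideanreal f \<and> (\<forall>x \<in> topspace X. 0 \<le> f x) \<and>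
     (\<forall>\<epsilon>>0. \<exists>K. compactin X K \<and> (\<forall>x \<in> topspace X - K. f x < \<epsilon>))}"

(* Integrating over [0,\<infinity>) rather than [0,b] avoids a choice of the bound b;
   see dtm_integral_eq below for the agreement of the two. *)
definition dtm_integral :: "'a topology \<Rightarrow> ('a set \<Rightarrow> ennreal) \<Rightarrow> ('a \<Rightarrow> real) \<Rightarrow> real" where
  "dtm_integral X \<nu> f = enn2real (\<integral>\<^sup>+ t \<in> {0..}. \<nu> {x \<in> topspace X. t < f x} \<partial>lborel)"

definition weak_topology :: "'a topology \<Rightarrow> ('a set \<Rightarrow> ennreal) topology" where
  "weak_topology X = topology_generated_by
     {{\<mu> \<in> DTM X. dtm_integral X \<mu> f \<in> V} | f V. f \<in> C0_plus X \<and> open V}"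

definition nowhere_dense_in :: "'b topology \<Rightarrow> 'b set \<Rightarrow> bool" where
  "nowhere_dense_in T S \<longleftrightarrow> S \<subseteq> topspace T \<and> T interior_of (T closure_of S) = {}"

lemma deficient_topological_measure_empty:
  assumes "deficient_topological_measure X \<nu>"
  shows "\<nu> {} = 0"
proof -
  have add: "\<nu> ({} \<union> {}) = \<nu> {} + \<nu> {}"
    and sup: "\<And>U. openin X U \<Longrightarrow> \<nu> U = (SUP C \<in> {C. compactin X C \<and> C \<subseteq> U}. \<nu> C)"
    and inf: "\<And>F. closedin X F \<Longrightarrow> \<nu> F = (INF U \<in> {U. openin X U \<and> F \<subseteq> U}. \<nu> U)"
    and fin: "\<exists>A \<in> open_or_closed X. \<nu> A \<noteq> \<infinity>"
    using assms unfolding deficient_topological_measure_def by blast+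
  have op: "\<nu> {} \<le> \<nu> U" if "openin X U" for U
    unfolding sup[OF that] by (rule SUP_upper) auto
  have "\<nu> {} \<le> \<nu> F" if "closedin X F" for F
    unfolding inf[OF that] by (rule INF_greatest) (auto intro: op)
  with op fin have "\<nu> {} \<noteq> \<infinity>"
    unfolding open_or_closed_def by (force simp: top_unique)
  then show ?thesis
    using add by (cases "\<nu> {}") (auto simp flip: ennreal_plus)
qed

lemma dtm_integral_eq:
  assumes "deficient_topological_measure X \<nu>" and "f \<in> topspace X \<rightarrow> {0..b}"
  shows "dtm_integral X \<nu> f =
    enn2real (\<integral>\<^sup>+ t \<in> {0..b}. \<nu> {x \<in> topspace X. t < f x} \<partial>lborel)"
proof -
  have "\<nu> {x \<in> topspace X. t < f x} * indicator {0..} t =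
      \<nu> {x \<in> topspace X. t < f x} * indicator {0..b} t" for t
  proof (cases "t \<le> b")
    case False
    then have "{x \<in> topspace X. t < f x} = {}"
      using assms(2) by (auto dest!: funcset_mem)
    then show ?thesis
      by (simp only: deficient_topological_measure_empty[OF assms(1)] mult_zero_left)
  qed (auto simp: indicator_def)
  then show ?thesis
    by (simp add: dtm_integral_def)
qed

lemma topspace_weak_topology [simp]: "topspace (weak_topology X) = DTM X"
proof -
  have "(\<lambda>_. 0) \<in> C0_plus X"
    unfolding C0_plus_def by (auto intro: exI[of _ "{}"])
  then have "DTM X \<in> {{\<mu> \<in> DTM X. dtm_integral X \<mu> f \<in> V} | f V. f \<in> C0_plus X \<and> open V}"
    by (auto intro!: exI[of _ "\<lambda>_. 0"] exI[of _ UNIV])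
  then show ?thesis
    unfolding weak_topology_def by auto
qed

lemma continuous_map_weak_topology:
  assumes "f \<in> C0_plus X"
  shows "continuous_map (weak_topology X) euclideanreal (\<lambda>\<mu>. dtm_integral X \<mu> f)"
  unfolding continuous_map topspace_weak_topology
  using assms by (auto simp: weak_topology_def intro!: topology_generated_by_Basis)

lemma weak_topology_coarsest:
  assumes "topspace T = DTM X"
    and "\<And>f. f \<in> C0_plus X \<Longrightarrow> continuous_map T euclideanreal (\<lambda>\<mu>. dtm_integral X \<mu> f)"
    and "openin (weak_topology X) W"
  shows "openin T W"
proof -
  have "generate_topology_on
      {{\<mu> \<in> DTM X. dtm_integral X \<mu> f \<in> V} | f V. f \<in> C0_plus X \<and> open V} W"
    using assms(3) by (simp add: weak_topology_def openin_topology_generated_by_iff)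
  then show ?thesis
  proof induction
    case (Basis W)
    then obtain f V where "f \<in> C0_plus X" "open V" "W = {\<mu> \<in> DTM X. dtm_integral X \<mu> f \<in> V}"
      by blast
    then show ?case
      using assms(2)[of f] unfolding continuous_map assms(1) by auto
  qed auto
qed

end

theory Submission
  imports Defs
begin

text \<open>
Let \<open>\<nu>\<close> be a finite deficient topological measure on a locally compact Hausdorff space. It is always
superadditive, and it is a measure exactly if it is subadditive on open sets
(\<open>Meas_iff_subadditive\<close>): subadditivity extends to countable unions of open sets by compactness, and
superadditivity makes open sets measurable in the sense of Caratheodory. Every set
function shown below to be a measure is recognised by this criterion.

\<^bold>\<open>Measures form a closed set.\<close> Superlevel sets of a maximum are unions of superlevel sets, so a
subadditive \<open>\<nu>\<close> satisfies \<open>\<integral> max f g d\<nu> \<le> \<integral> f d\<nu> + \<integral> g d\<nu>\<close> for all \<open>f\<close> and \<open>g\<close> that are nonnegative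
and vanish at infinity. Conversely, cutoff functions recover subadditivity from these inequalities,
which are closed conditions in the weak topology (\<open>closedin_Meas\<close>).

\<^bold>\<open>They have no interior if some \<nu> is not a measure.\<close> If \<open>\<mu>\<close> were an interior point, then \<open>\<mu> + c \<nu>\<close> would be
a measure for small \<open>c > 0\<close>. Measures satisfy inclusion-exclusion on open sets, an identity that passes
to \<open>\<nu>\<close> by subtraction; so \<open>\<nu>\<close> would be a measure (\<open>Meas_if_add_scaled_Meas\<close>).

\<^bold>\<open>Non-measures have a nonzero proper part.\<close> Suprema of chains of measures below \<open>\<nu>\<close> are measures
(\<open>SUP_chain_in_Meas\<close>), so by Zorn's lemma there is a maximal measure \<open>m \<le> \<nu>\<close>. Because \<open>\<nu>\<close> is
superadditive and \<open>m\<close> is additive, \<open>\<nu> - m\<close> is again a deficient topological measure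
(\<open>diff_on_in_DTM\<close>), and maximality of \<open>m\<close> says that it is proper (\<open>exists_nonzero_proper\<close>). In the other
direction, a proper measure lies above itself and hence is zero.

Sums \<open>\<mu> + c \<nu>\<close> and differences \<open>\<nu> - m\<close> inherit additivity, so the same argument works within
topological measures.
\<close>

section \<open>Deficient topological measures and approximation\<close>

lemma open_in_open_or_closed [simp]: "openin X A \<Longrightarrow> A \<in> open_or_closed X"
  and closed_in_open_or_closed [simp]: "closedin X A \<Longrightarrow> A \<in> open_or_closed X"
  by (auto simp: open_or_closed_def)

lemma open_or_closed_subset: "A \<in> open_or_closed X \<Longrightarrow> A \<subseteq> topspace X"
  by (auto simp: open_or_closed_def dest: openin_subset closedin_subset)

lemma DTM_extensional: "\<nu> \<in> DTM X \<Longrightarrow> \<nu> \<in> extensional (open_or_closed X)"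
  by (simp add: DTM_def deficient_topological_measure_def)

lemma DTM_empty: "\<nu> \<in> DTM X \<Longrightarrow> \<nu> {} = 0"
  by (auto simp: DTM_def deficient_topological_measure_empty)

lemma DTM_compact_Un:
  "\<lbrakk>\<nu> \<in> DTM X; compactin X C; compactin X K; C \<inter> K = {}\<rbrakk> \<Longrightarrow> \<nu> (C \<union> K) = \<nu> C + \<nu> K"
  by (auto simp: DTM_def deficient_topological_measure_def)

lemma DTM_open_eq_SUP:
  "\<lbrakk>\<nu> \<in> DTM X; openin X U\<rbrakk> \<Longrightarrow> \<nu> U = (SUP C \<in> {C. compactin X C \<and> C \<subseteq> U}. \<nu> C)"
  by (auto simp: DTM_def deficient_topological_measure_def)

lemma DTM_closed_eq_INF:
  "\<lbrakk>\<nu> \<in> DTM X; closedin X F\<rbrakk> \<Longrightarrow> \<nu> F = (INF U \<in> {U. openin X U \<and> F \<subseteq> U}. \<nu> U)"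
  by (auto simp: DTM_def deficient_topological_measure_def)

text \<open>The value of a closed set is an infimum over open supersets, and that of an open set is a supremum
over compact subsets, so comparing \<open>A\<close> with the open sets that contain it settles all four cases.\<close>

lemma DTM_mono:
  assumes \<nu>: "\<nu> \<in> DTM X" and A: "A \<in> open_or_closed X" and B: "B \<in> open_or_closed X"
    and "A \<subseteq> B"
  shows "\<nu> A \<le> \<nu> B"
proof -
  have 1: "\<nu> A \<le> \<nu> U" if U: "openin X U" and "A \<subseteq> U" for U
  proof (cases "openin X A")
    case True
    then show ?thesis
      using that by (auto simp: DTM_open_eq_SUP[OF \<nu>] intro!: SUP_subset_mono)
  next
    case False
    then have "closedin X A"
      using A by (auto simp: open_or_closed_def)
    from DTM_closed_eq_INF[OF \<nu> this] show ?thesis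
      using that by (auto intro!: INF_lower)
  qed
  show ?thesis
  proof (cases "openin X B")
    case False
    then have "closedin X B"
      using B by (auto simp: open_or_closed_def)
    from DTM_closed_eq_INF[OF \<nu> this] show ?thesis
      using \<open>A \<subseteq> B\<close> by (auto intro!: INF_greatest 1)
  qed (use 1 \<open>A \<subseteq> B\<close> in auto)
qed

lemma DTM_le_topspace: "\<lbrakk>\<nu> \<in> DTM X; A \<in> open_or_closed X\<rbrakk> \<Longrightarrow> \<nu> A \<le> \<nu> (topspace X)"
  by (rule DTM_mono) (auto dest: open_or_closed_subset)

lemma DTM_finite:
  assumes "\<nu> \<in> DTM X" "A \<in> open_or_closed X" shows "\<nu> A < top"
  using DTM_le_topspace[OF assms] assms(1) by (auto simp: DTM_def intro: le_less_trans)

lemma DTM_inner: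
  assumes \<nu>: "\<nu> \<in> DTM X" and U: "openin X U" and "0 < e"
  shows "\<exists>K. compactin X K \<and> K \<subseteq> U \<and> \<nu> U \<le> \<nu> K + ennreal e"
proof -
  have "\<exists>K\<in>{C. compactin X C \<and> C \<subseteq> U}. \<nu> U < \<nu> K + ennreal e"
    using DTM_finite[OF \<nu>, of U] U
    by (intro SUP_approx_ennreal[OF \<open>0 < e\<close> _ DTM_open_eq_SUP[OF \<nu> U]]) auto
  then show ?thesis by (auto intro: less_imp_le)
qed

lemma DTM_outer:
  assumes \<nu>: "\<nu> \<in> DTM X" and F: "closedin X F" and "0 < e"
  shows "\<exists>U. openin X U \<and> F \<subseteq> U \<and> \<nu> U \<le> \<nu> F + ennreal e"
proof -
  have "\<exists>U\<in>{U. openin X U \<and> F \<subseteq> U}. \<nu> U < \<nu> F + ennreal e"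
    using DTM_finite[OF \<nu>, of F] F
    by (intro INF_approx_ennreal[OF \<open>0 < e\<close> DTM_closed_eq_INF[OF \<nu> F]]) auto
  then show ?thesis by (auto intro: less_imp_le)
qed

text \<open>For a finite set function (DTM2) and (DTM3) amount to \<open>\<epsilon>\<close>-approximation together with monotonicity
from closed to open sets. Every deficient topological measure constructed below (combinations,
differences, suprema of chains) is verified in this form, because approximating sets can be combined
by unions and intersections, while suprema and infima do not commute with sums directly.\<close>

lemma DTM_by_approximation:
  assumes H: "Hausdorff_space X"
    and ext: "\<nu> \<in> extensional (open_or_closed X)"
    and fin: "\<nu> (topspace X) < top"
    and mono: "\<And>F U. \<lbrakk>closedin X F; openin X U; F \<subseteq> U\<rbrakk> \<Longrightarrow> \<nu> F \<le> \<nu> U"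
    and add: "\<And>C K. \<lbrakk>compactin X C; compactin X K; C \<inter> K = {}\<rbrakk> \<Longrightarrow> \<nu> (C \<union> K) = \<nu> C + \<nu> K"
    and inner: "\<And>U e. \<lbrakk>openin X U; 0 < e\<rbrakk> \<Longrightarrow> \<exists>K. compactin X K \<and> K \<subseteq> U \<and> \<nu> U \<le> \<nu> K + ennreal e"
    and outer: "\<And>F e. \<lbrakk>closedin X F; 0 < e\<rbrakk> \<Longrightarrow> \<exists>U. openin X U \<and> F \<subseteq> U \<and> \<nu> U \<le> \<nu> F + ennreal e"
  shows "\<nu> \<in> DTM X"
proof -
  have "\<nu> U = (SUP C \<in> {C. compactin X C \<and> C \<subseteq> U}. \<nu> C)" if U: "openin X U" for U
  proof (rule antisym)
    show "\<nu> U \<le> (SUP C \<in> {C. compactin X C \<and> C \<subseteq> U}. \<nu> C)"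
    proof (rule ennreal_le_epsilon)
      fix e :: real assume "0 < e"
      with inner[OF U this] obtain K where K: "compactin X K" "K \<subseteq> U" "\<nu> U \<le> \<nu> K + ennreal e"
        by auto
      have "\<nu> K \<le> (SUP C \<in> {C. compactin X C \<and> C \<subseteq> U}. \<nu> C)"
        using K by (intro SUP_upper) auto
      with K show "\<nu> U \<le> (SUP C \<in> {C. compactin X C \<and> C \<subseteq> U}. \<nu> C) + ennreal e"
        by (meson add_right_mono order_trans)
    qed
  qed (auto intro!: SUP_least mono compactin_imp_closedin[OF H] U)
  moreover have "\<nu> F = (INF U \<in> {U. openin X U \<and> F \<subseteq> U}. \<nu> U)" if F: "closedin X F" for F
  proof (rule antisym)
    show "(INF U \<in> {U. openin X U \<and> F \<subseteq> U}. \<nu> U) \<le> \<nu> F"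
    proof (rule ennreal_le_epsilon)
      fix e :: real assume "0 < e"
      with outer[OF F this] obtain U where K: "openin X U" "F \<subseteq> U" "\<nu> U \<le> \<nu> F + ennreal e"
        by auto
      then show "(INF U \<in> {U. openin X U \<and> F \<subseteq> U}. \<nu> U) \<le> \<nu> F + ennreal e"
        by (intro INF_lower2[of U]) auto
    qed
  qed (auto intro!: INF_greatest mono F)
  moreover have "\<exists>A \<in> open_or_closed X. \<nu> A \<noteq> \<infinity>"
    using fin by (intro bexI[of _ "topspace X"]) auto
  ultimately show ?thesis
    using ext fin add by (auto simp: DTM_def deficient_topological_measure_def)
qed

lemma TM_iff:
  "\<mu> \<in> TM X \<longleftrightarrow> \<mu> \<in> DTM X \<and>
     (\<forall>A B. (compactin X A \<or> openin X A) \<and> (compactin X B \<or> openin X B) \<and>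
        (compactin X (A \<union> B) \<or> openin X (A \<union> B)) \<and> A \<inter> B = {} \<longrightarrow> \<mu> (A \<union> B) = \<mu> A + \<mu> B)"
  unfolding TM_def DTM_def topological_measure_def deficient_topological_measure_def mem_Collect_eq
  by (intro iffI conjI; (elim conjE)?; (assumption | blast intro: compactin_Un)?)

lemma TM_additive:
  assumes "\<mu> \<in> TM X" "compactin X A \<or> openin X A" "compactin X B \<or> openin X B"
    "compactin X (A \<union> B) \<or> openin X (A \<union> B)" "A \<inter> B = {}"
  shows "\<mu> (A \<union> B) = \<mu> A + \<mu> B"
  using assms unfolding TM_iff by blast

text \<open>For a compact \<open>C \<subseteq> U - F\<close> the set \<open>U - C\<close> is an open neighbourhood of \<open>F\<close>. A compact subset of
\<open>U - C\<close> that carries nearly all of its mass is disjoint from \<open>C\<close>, so that (DTM1) applies to the two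
compact sets. A closed \<open>F\<close> need not be approximable from inside by compact sets; passing through
\<open>U - C\<close> avoids this.\<close>

lemma DTM_superadditive:
  assumes \<nu>: "\<nu> \<in> DTM X" and H: "Hausdorff_space X" and F: "closedin X F" and U: "openin X U"
    and "F \<subseteq> U"
  shows "\<nu> F + \<nu> (U - F) \<le> \<nu> U"
proof (rule ennreal_le_epsilon)
  fix e :: real assume e: "0 < e"
  obtain C where C: "compactin X C" "C \<subseteq> U - F" "\<nu> (U - F) \<le> \<nu> C + ennreal (e/2)"
    using DTM_inner[OF \<nu> openin_diff[OF U F], of "e/2"] e by auto
  have V: "openin X (U - C)"
    using openin_diff[OF U compactin_imp_closedin[OF H C(1)]] .
  obtain K where K: "compactin X K" "K \<subseteq> U - C" "\<nu> (U - C) \<le> \<nu> K + ennreal (e/2)"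
    using DTM_inner[OF \<nu> V, of "e/2"] e by auto
  have "\<nu> F \<le> \<nu> (U - C)"
    using C \<open>F \<subseteq> U\<close> V F by (intro DTM_mono[OF \<nu>]) auto
  then have "\<nu> F + \<nu> (U - F) \<le> (\<nu> K + ennreal (e/2)) + (\<nu> C + ennreal (e/2))"
    using C K by (intro add_mono order_trans[OF _ K(3)])
  also have "\<dots> = \<nu> (K \<union> C) + ennreal e"
    using DTM_compact_Un[OF \<nu> K(1) C(1)] K(2) e
    by (subst DTM_compact_Un[OF \<nu> K(1) C(1)]) (auto simp: ac_simps simp flip: ennreal_plus)
  also have "\<nu> (K \<union> C) \<le> \<nu> U"
    using K C U compactin_imp_closedin[OF H compactin_Un[OF K(1) C(1)]]
    by (intro DTM_mono[OF \<nu>]) auto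
  finally show "\<nu> F + \<nu> (U - F) \<le> \<nu> U + ennreal e"
    by (simp add: add_right_mono)
qed

section \<open>Measures among topological measures\<close>

lemma open_or_closed_sets:
  assumes "borel_measure_on X m" shows "open_or_closed X \<subseteq> sets m"
proof -
  have op: "A \<in> sets m" if "openin X A" for A
    using assms that by (auto simp: borel_measure_on_def)
  moreover have "A \<in> sets m" if "closedin X A" for A
  proof -
    have "topspace X - (topspace X - A) \<in> sets m"
      using that by (intro sets.Diff op) auto
    then show ?thesis
      using closedin_subset[OF that] by (simp add: double_diff)
  qed
  ultimately show ?thesis by (auto simp: open_or_closed_def)
qed

lemma Meas_obtain:
  assumes "\<mu> \<in> Meas X"
  obtains m where "regular_borel_measure_on X m" "finite_measure m"
    "\<And>A. A \<in> open_or_closed X \<Longrightarrow> \<mu> A = emeasure m A" "open_or_closed X \<subseteq> sets m"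
    "\<mu> \<in> extensional (open_or_closed X)"
proof -
  obtain m where m: "regular_borel_measure_on X m" "finite_measure m"
    and eq: "\<mu> = restrict (emeasure m) (open_or_closed X)"
    using assms by (auto simp: Meas_def)
  then have "open_or_closed X \<subseteq> sets m"
    by (intro open_or_closed_sets) (auto simp: regular_borel_measure_on_def)
  with m eq show thesis by (intro that) auto
qed

text \<open>The inclusion-exclusion identity is linear in \<open>\<mu>\<close>. It is therefore inherited by differences of
measures, which the inequality of subadditivity would not be.\<close>

lemma Meas_modular:
  assumes "\<mu> \<in> Meas X" "openin X U" "openin X V"
  shows "\<mu> U + \<mu> V = \<mu> (U \<union> V) + \<mu> (U \<inter> V)"
proof -
  from assms(1) obtain m where m: "\<And>A. A \<in> open_or_closed X \<Longrightarrow> \<mu> A = emeasure m A"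
    and s: "open_or_closed X \<subseteq> sets m"
    by (rule Meas_obtain) blast
  have "U \<in> sets m" "V \<in> sets m"
    using assms s by auto
  from emeasure_Un_Int[OF this] show ?thesis
    using assms by (simp add: m openin_Un openin_Int)
qed

lemma Meas_subset_TM:
  assumes H: "Hausdorff_space X" shows "Meas X \<subseteq> TM X"
proof
  fix \<mu> assume "\<mu> \<in> Meas X"
  then obtain m where m: "regular_borel_measure_on X m" "finite_measure m"
    "\<And>A. A \<in> open_or_closed X \<Longrightarrow> \<mu> A = emeasure m A" and s: "open_or_closed X \<subseteq> sets m"
    and ext: "\<mu> \<in> extensional (open_or_closed X)"
    by (rule Meas_obtain) blast
  have fin: "\<mu> (topspace X) < \<infinity>"
    using finite_measure.emeasure_finite[OF m(2), of "topspace X"] m(3)[of "topspace X"]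
    by (simp add: less_top)
  have add: "\<mu> (A \<union> B) = \<mu> A + \<mu> B" if "compactin X A \<or> openin X A" "compactin X B \<or> openin X B"
    "compactin X (A \<union> B) \<or> openin X (A \<union> B)" "A \<inter> B = {}" for A B
  proof -
    have *: "C \<in> open_or_closed X" if "compactin X C \<or> openin X C" for C
      using that compactin_imp_closedin[OF H] by auto
    then show ?thesis
      using that s *[of A] *[of B] *[of "A \<union> B"] by (subst (1 2 3) m(3)) (auto intro!: plus_emeasure[symmetric])
  qed
  have "\<mu> U = (SUP C \<in> {C. compactin X C \<and> C \<subseteq> U}. \<mu> C)" if U: "openin X U" for U
  proof -
    have "emeasure m U = (SUP C \<in> {C. compactin X C \<and> C \<subseteq> U}. emeasure m C)"
      using m(1) U by (auto simp: regular_borel_measure_on_def)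
    also have "\<dots> = (SUP C \<in> {C. compactin X C \<and> C \<subseteq> U}. \<mu> C)"
      using m(3) compactin_imp_closedin[OF H] by (intro SUP_cong) auto
    finally show ?thesis using m(3) U by simp
  qed
  moreover have "\<mu> F = (INF U \<in> {U. openin X U \<and> F \<subseteq> U}. \<mu> U)" if F: "closedin X F" for F
  proof -
    have "F \<in> sets m" using F s by auto
    then have "emeasure m F = (INF U \<in> {U. openin X U \<and> F \<subseteq> U}. emeasure m U)"
      using m(1) unfolding regular_borel_measure_on_def by blast
    also have "\<dots> = (INF U \<in> {U. openin X U \<and> F \<subseteq> U}. \<mu> U)"
      using m(3) by (intro INF_cong) auto
    finally show ?thesis using m(3) F by simp
  qed
  moreover have "\<exists>A \<in> open_or_closed X. \<mu> A \<noteq> \<infinity>"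
    using fin by (intro bexI[of _ "topspace X"]) auto
  ultimately show "\<mu> \<in> TM X"
    using add ext fin by (auto simp: TM_def topological_measure_def)
qed

lemma Meas_imp_TM: "\<lbrakk>Hausdorff_space X; \<mu> \<in> Meas X\<rbrakk> \<Longrightarrow> \<mu> \<in> TM X"
  using Meas_subset_TM by blast

lemma Meas_imp_DTM: "\<lbrakk>Hausdorff_space X; \<mu> \<in> Meas X\<rbrakk> \<Longrightarrow> \<mu> \<in> DTM X"
  using Meas_imp_TM TM_iff by blast

lemma Meas_closed_open_add:
  assumes "\<mu> \<in> Meas X" "closedin X F" "openin X U" "F \<subseteq> U"
  shows "\<mu> F + \<mu> (U - F) = \<mu> U"
proof -
  from assms(1) obtain m where m: "\<And>A. A \<in> open_or_closed X \<Longrightarrow> \<mu> A = emeasure m A"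
    and s: "open_or_closed X \<subseteq> sets m"
    by (rule Meas_obtain) blast
  have o: "openin X (U - F)"
    using assms by (intro openin_diff)
  then have "F \<in> sets m" "U - F \<in> sets m"
    using subsetD[OF s closed_in_open_or_closed[OF assms(2)]]
      subsetD[OF s open_in_open_or_closed[OF o]] by auto
  with plus_emeasure[of F m "U - F"] assms o show ?thesis
    by (simp add: m Un_absorb1)
qed

section \<open>Measures as subadditive deficient topological measures\<close>

text \<open>The condition is imposed for overlapping sets as well; for disjoint open sets every deficient
topological measure is superadditive, and subadditivity there would only say that it is additive.\<close>

definition subadditive_on_open :: "'a topology \<Rightarrow> ('a set \<Rightarrow> ennreal) \<Rightarrow> bool" where
  "subadditive_on_open X \<nu> \<longleftrightarrow>
     (\<forall>U V. openin X U \<longrightarrow> openin X V \<longrightarrow> \<nu> (U \<union> V) \<le> \<nu> U + \<nu> V)"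

text \<open>Finite subadditivity becomes countable because \<open>\<nu>\<close> of an open set is seen on its compact subsets,
and each of these is covered by finitely many of the \<open>U i\<close>.\<close>

lemma subadditive_on_open_UN_le_suminf:
  assumes H: "Hausdorff_space X" and \<nu>: "\<nu> \<in> DTM X" and sub: "subadditive_on_open X \<nu>"
    and U: "\<And>i::nat. openin X (U i)"
  shows "\<nu> (\<Union>i. U i) \<le> (\<Sum>i. \<nu> (U i))"
proof -
  have fin: "\<nu> (\<Union>i\<in>I. U i) \<le> (\<Sum>i\<in>I. \<nu> (U i))" if "finite I" for I
    using that
  proof induction
    case (insert i I)
    have "\<nu> (U i \<union> (\<Union>i\<in>I. U i)) \<le> \<nu> (U i) + \<nu> (\<Union>i\<in>I. U i)"
      using sub U openin_Union[of "U ` I" X] by (auto simp: subadditive_on_open_def)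
    with insert show ?case
      by (simp add: order_trans[OF _ add_left_mono])
  qed (simp add: DTM_empty[OF \<nu>])
  have O: "openin X (\<Union>i\<in>I. U i)" for I
    using U by (auto intro!: openin_Union)
  have "\<nu> K \<le> (\<Sum>i. \<nu> (U i))" if K: "compactin X K" "K \<subseteq> (\<Union>i. U i)" for K
  proof -
    obtain \<F> where \<F>: "finite \<F>" "\<F> \<subseteq> range U" "K \<subseteq> \<Union>\<F>"
      using K U unfolding compactin_def by (metis imageE)
    then obtain I where I: "finite I" "\<F> = U ` I"
      by (meson finite_subset_image)
    have "\<nu> K \<le> \<nu> (\<Union>i\<in>I. U i)"
      using \<F> I O compactin_imp_closedin[OF H K(1)] by (intro DTM_mono[OF \<nu>]) auto
    also have "\<dots> \<le> (\<Sum>i\<in>I. \<nu> (U i))" by (rule fin[OF I(1)])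
    also have "\<dots> \<le> (\<Sum>i. \<nu> (U i))" using I by (intro sum_le_suminf) auto
    finally show ?thesis .
  qed
  then show ?thesis
    by (auto simp: DTM_open_eq_SUP[OF \<nu> O] intro!: SUP_least)
qed

text \<open>The Caratheodory outer measure of \<open>\<nu>\<close>, defined on all subsets of the space.\<close>

definition outer_extension :: "'a topology \<Rightarrow> ('a set \<Rightarrow> ennreal) \<Rightarrow> 'a set \<Rightarrow> ennreal" where
  "outer_extension X \<nu> A = (INF U \<in> {U. openin X U \<and> A \<subseteq> U}. \<nu> U)"

lemma outer_extension_eq:
  assumes \<nu>: "\<nu> \<in> DTM X" and A: "A \<in> open_or_closed X"
  shows "outer_extension X \<nu> A = \<nu> A"
proof (cases "openin X A")
  case True
  then show ?thesis
    unfolding outer_extension_def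
    by (intro antisym INF_greatest INF_lower) (auto intro!: DTM_mono[OF \<nu>])
next
  case False
  then have "closedin X A" using A by (auto simp: open_or_closed_def)
  from DTM_closed_eq_INF[OF \<nu> this] show ?thesis by (simp add: outer_extension_def)
qed

lemma outer_extension_mono: "A \<subseteq> B \<Longrightarrow> outer_extension X \<nu> A \<le> outer_extension X \<nu> B"
  unfolding outer_extension_def by (rule INF_superset_mono) auto

lemma outer_extension_approx:
  assumes \<nu>: "\<nu> \<in> DTM X" and A: "A \<subseteq> topspace X" and "0 < e"
  shows "\<exists>U. openin X U \<and> A \<subseteq> U \<and> \<nu> U \<le> outer_extension X \<nu> A + ennreal e"
proof -
  have "outer_extension X \<nu> A \<le> \<nu> (topspace X)"
    using outer_extension_mono[OF A, of X \<nu>] by (simp add: outer_extension_eq[OF \<nu>])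
  then have "outer_extension X \<nu> A \<noteq> \<infinity>"
    using \<nu> by (auto simp: DTM_def top_unique)
  then have "\<exists>U\<in>{U. openin X U \<and> A \<subseteq> U}. \<nu> U < outer_extension X \<nu> A + ennreal e"
    by (intro INF_approx_ennreal[OF \<open>0 < e\<close>]) (auto simp: outer_extension_def)
  then show ?thesis by (auto intro: less_imp_le)
qed

lemma outer_measure_space_outer_extension:
  assumes H: "Hausdorff_space X" and \<nu>: "\<nu> \<in> DTM X" and sub: "subadditive_on_open X \<nu>"
  shows "outer_measure_space (Pow (topspace X)) (outer_extension X \<nu>)"
  unfolding outer_measure_space_def
proof (intro conjI)
  show "positive (Pow (topspace X)) (outer_extension X \<nu>)"
    by (simp add: positive_def outer_extension_eq[OF \<nu>] DTM_empty[OF \<nu>])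
  show "increasing (Pow (topspace X)) (outer_extension X \<nu>)"
    by (auto simp: increasing_def intro: outer_extension_mono)
  show "countably_subadditive (Pow (topspace X)) (outer_extension X \<nu>)"
    unfolding countably_subadditive_def
  proof (intro allI impI, rule ennreal_le_epsilon)
    fix A :: "nat \<Rightarrow> 'a set" and e :: real
    assume A: "range A \<subseteq> Pow (topspace X)" and e: "0 < e"
    let ?O = "outer_extension X \<nu>"
    have "\<exists>U. openin X U \<and> A n \<subseteq> U \<and> \<nu> U \<le> ?O (A n) + ennreal (e * (1/2) ^ Suc n)" for n
      using A e by (intro outer_extension_approx[OF \<nu>]) auto
    then obtain U where U: "\<And>n. openin X (U n)" "\<And>n. A n \<subseteq> U n"
      "\<And>n. \<nu> (U n) \<le> ?O (A n) + ennreal (e * (1/2) ^ Suc n)"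
      by metis
    have "?O (\<Union>i. A i) \<le> ?O (\<Union>i. U i)"
      using U(2) by (intro outer_extension_mono UN_mono) auto
    also have "\<dots> = \<nu> (\<Union>i. U i)"
      using U(1) by (intro outer_extension_eq[OF \<nu>] open_in_open_or_closed openin_Union) auto
    also have "\<dots> \<le> (\<Sum>n. \<nu> (U n))"
      by (rule subadditive_on_open_UN_le_suminf[OF H \<nu> sub U(1)])
    also have "\<dots> \<le> (\<Sum>n. ?O (A n) + ennreal e * ennreal ((1/2) ^ Suc n))"
      using U(3) e by (intro suminf_le) (auto simp flip: ennreal_mult)
    also have "\<dots> = (\<Sum>n. ?O (A n)) + ennreal e"
      unfolding ennreal_suminf_cmult suminf_add[OF summableI summableI, symmetric]
      by (subst suminf_ennreal_eq[OF zero_le_power power_half_series]) auto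
    finally show "?O (\<Union>i. A i) \<le> (\<Sum>n. ?O (A n)) + ennreal e" .
  qed
qed

text \<open>If \<open>K\<close> is a compact subset of \<open>V \<inter> U\<close> of nearly full mass, where \<open>V\<close> is an open superset of \<open>A\<close>, then
the outer measure of \<open>A \<inter> U\<close> is at most about \<open>\<nu> K\<close>, the open set \<open>V - K\<close> contains \<open>A - U\<close>, and
superadditivity bounds the sum of \<open>\<nu> K\<close> and \<open>\<nu> (V - K)\<close> by \<open>\<nu> V\<close>.\<close>

lemma open_in_lambda_system:
  assumes H: "Hausdorff_space X" and \<nu>: "\<nu> \<in> DTM X" and sub: "subadditive_on_open X \<nu>"
    and U: "openin X U"
  shows "U \<in> lambda_system (topspace X) (Pow (topspace X)) (outer_extension X \<nu>)"
proof -
  let ?O = "outer_extension X \<nu>"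
  interpret algebra "topspace X" "Pow (topspace X)" by (rule algebra_Pow)
  have oms: "outer_measure_space (Pow (topspace X)) ?O"
    by (rule outer_measure_space_outer_extension[OF H \<nu> sub])
  then have "subadditive (Pow (topspace X)) ?O"
    unfolding outer_measure_space_def by (auto intro: countably_subadditive_subadditive)
  from subadditiveD[OF this, of "A \<inter> U" "A - U" for A]
  have le: "?O A \<le> ?O (A \<inter> U) + ?O (A - U)" if "A \<subseteq> topspace X" for A
    using that by (simp add: Int_Diff_Un) (metis Diff_subset Int_Diff_Un Int_Diff_disjoint Int_lower1 order_trans)
  have "?O (A \<inter> U) + ?O (A - U) \<le> ?O A" if A: "A \<subseteq> topspace X" for A
  proof (rule ennreal_le_epsilon)
    fix e :: real assume e: "0 < e"
    obtain V where V: "openin X V" "A \<subseteq> V" "\<nu> V \<le> ?O A + ennreal (e/2)"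
      using outer_extension_approx[OF \<nu> A, of "e/2"] e by auto
    have VU: "openin X (V \<inter> U)" using V U by auto
    obtain K where K: "compactin X K" "K \<subseteq> V \<inter> U" "\<nu> (V \<inter> U) \<le> \<nu> K + ennreal (e/2)"
      using DTM_inner[OF \<nu> VU, of "e/2"] e by auto
    have cK: "closedin X K" using compactin_imp_closedin[OF H K(1)] .
    have oVK: "openin X (V - K)" using V(1) cK by auto
    have "?O (A \<inter> U) \<le> ?O (V \<inter> U)" using V(2) by (intro outer_extension_mono) auto
    also have "\<dots> = \<nu> (V \<inter> U)" using VU by (simp add: outer_extension_eq[OF \<nu>])
    finally have 1: "?O (A \<inter> U) \<le> \<nu> K + ennreal (e/2)" using K(3) by (rule order_trans)
    have "?O (A - U) \<le> ?O (V - K)" using V(2) K(2) by (intro outer_extension_mono) auto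
    also have "\<dots> = \<nu> (V - K)" using oVK by (simp add: outer_extension_eq[OF \<nu>])
    finally have "?O (A \<inter> U) + ?O (A - U) \<le> \<nu> K + ennreal (e/2) + \<nu> (V - K)"
      by (intro add_mono 1)
    also have "\<dots> \<le> \<nu> V + ennreal (e/2)"
      using DTM_superadditive[OF \<nu> H cK V(1)] K(2)
      by (metis add.assoc add.commute add_right_mono le_inf_iff)
    also have "\<dots> \<le> (?O A + ennreal (e/2)) + ennreal (e/2)"
      by (intro add_right_mono V)
    also have "\<dots> = ?O A + ennreal e"
      using e by (simp add: add.assoc flip: ennreal_plus)
    finally show "?O (A \<inter> U) + ?O (A - U) \<le> ?O A + ennreal e" .
  qed
  with le openin_subset[OF U] show ?thesis
    unfolding lambda_system_eq by (auto intro!: antisym)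
qed

lemma subadditive_imp_Meas:
  assumes H: "Hausdorff_space X" and \<nu>: "\<nu> \<in> DTM X" and sub: "subadditive_on_open X \<nu>"
  shows "\<nu> \<in> Meas X"
proof -
  let ?O = "outer_extension X \<nu>"
  let ?L = "lambda_system (topspace X) (Pow (topspace X)) ?O"
  let ?B = "sigma_sets (topspace X) {U. openin X U}"
  interpret sigma_algebra "topspace X" "Pow (topspace X)" by (rule sigma_algebra_Pow)
  have ms: "measure_space (topspace X) ?L ?O"
    by (rule caratheodory_lemma[OF outer_measure_space_outer_extension[OF H \<nu> sub]])
  then have "sigma_algebra (topspace X) ?L" by (simp add: measure_space_def)
  then have BL: "?B \<subseteq> ?L"
    using open_in_lambda_system[OF H \<nu> sub] by (intro sigma_algebra.sigma_sets_subset) auto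
  define m where "m = measure_of (topspace X) {U. openin X U} ?O"
  have sub': "{U. openin X U} \<subseteq> Pow (topspace X)" by (auto dest: openin_subset)
  have sets: "sets m = ?B" and space: "space m = topspace X"
    using sub' by (auto simp: m_def)
  have pos: "positive ?B ?O"
    using ms BL by (simp add: measure_space_def positive_def)
  have ca: "countably_additive ?B ?O"
    using ms BL unfolding measure_space_def countably_additive_def by blast
  have em: "emeasure m A = ?O A" if "A \<in> ?B" for A
    using that pos ca sub' by (intro emeasure_measure_of[OF m_def]) (auto simp: sets)
  have b: "borel_measure_on X m" by (simp add: borel_measure_on_def sets space)
  have emo: "emeasure m A = \<nu> A" if "A \<in> open_or_closed X" for A
    using that open_or_closed_sets[OF b] by (auto simp: sets em outer_extension_eq[OF \<nu>])
  have "regular_borel_measure_on X m"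
    unfolding regular_borel_measure_on_def
  proof (intro conjI b ballI allI impI)
    show "emeasure m A = (INF U \<in> {U. openin X U \<and> A \<subseteq> U}. emeasure m U)" if "A \<in> sets m" for A
    proof -
      have "emeasure m A = (INF U \<in> {U. openin X U \<and> A \<subseteq> U}. \<nu> U)"
        using that by (simp add: sets em outer_extension_def)
      also have "\<dots> = (INF U \<in> {U. openin X U \<and> A \<subseteq> U}. emeasure m U)"
        by (intro INF_cong) (auto simp: emo)
      finally show ?thesis .
    qed
    show "emeasure m U = (SUP C \<in> {C. compactin X C \<and> C \<subseteq> U}. emeasure m C)"
      if U: "openin X U" for U
    proof -
      have "emeasure m U = (SUP C \<in> {C. compactin X C \<and> C \<subseteq> U}. \<nu> C)"
        using U by (simp add: emo DTM_open_eq_SUP[OF \<nu>])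
      also have "\<dots> = (SUP C \<in> {C. compactin X C \<and> C \<subseteq> U}. emeasure m C)"
        by (intro SUP_cong) (auto simp: emo compactin_imp_closedin[OF H])
      finally show ?thesis .
    qed
  qed
  moreover have "finite_measure m"
    using DTM_finite[OF \<nu>, of "topspace X"] by (intro finite_measureI) (simp add: space emo)
  moreover have "\<nu> = restrict (emeasure m) (open_or_closed X)"
    using DTM_extensional[OF \<nu>] by (intro extensionalityI[of _ "open_or_closed X"]) (auto simp: emo)
  ultimately show ?thesis by (auto simp: Meas_def)
qed

text \<open>This criterion is how sums, suprema of chains and weak limits are recognised as measures: it is a
condition on open sets, so that no measure on the Borel sets has to be constructed each time.\<close>

lemma Meas_iff_subadditive:
  assumes H: "Hausdorff_space X"
  shows "\<mu> \<in> Meas X \<longleftrightarrow> \<mu> \<in> DTM X \<and> subadditive_on_open X \<mu>"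
proof (intro iffI conjI)
  assume \<mu>: "\<mu> \<in> Meas X"
  then show "\<mu> \<in> DTM X" by (rule Meas_imp_DTM[OF H])
  show "subadditive_on_open X \<mu>"
    using Meas_modular[OF \<mu>] by (auto simp: subadditive_on_open_def)
qed (use subadditive_imp_Meas[OF H] in blast)

section \<open>Positive combinations\<close>

text \<open>The half-line \<open>\<mu> + c \<nu>\<close>, \<open>c \<ge> 0\<close>, along which \<open>\<mu>\<close> is perturbed. The restriction to \<open>O(X) \<union> C(X)\<close>
keeps the sum extensional, as membership in \<open>DTM X\<close> demands.\<close>

definition add_scaled ::
  "'a topology \<Rightarrow> ('a set \<Rightarrow> ennreal) \<Rightarrow> real \<Rightarrow> ('a set \<Rightarrow> ennreal) \<Rightarrow> ('a set \<Rightarrow> ennreal)" where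
  "add_scaled X \<mu> c \<nu> = (\<lambda>A\<in>open_or_closed X. \<mu> A + ennreal c * \<nu> A)"

lemma add_scaled_apply [simp]:
  "A \<in> open_or_closed X \<Longrightarrow> add_scaled X \<mu> c \<nu> A = \<mu> A + ennreal c * \<nu> A"
  by (simp add: add_scaled_def)

lemma add_scaled_0:
  assumes "\<mu> \<in> DTM X" shows "add_scaled X \<mu> 0 \<nu> = \<mu>"
  using DTM_extensional[OF assms]
  by (intro extensionalityI[of _ "open_or_closed X"]) (auto simp: add_scaled_def)

lemma add_scaled_in_DTM:
  assumes H: "Hausdorff_space X" and \<mu>: "\<mu> \<in> DTM X" and \<nu>: "\<nu> \<in> DTM X" and c: "0 \<le> c"
  shows "add_scaled X \<mu> c \<nu> \<in> DTM X"
proof (rule DTM_by_approximation[OF H])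
  show "add_scaled X \<mu> c \<nu> (topspace X) < top"
    using DTM_finite[OF \<mu>, of "topspace X"] DTM_finite[OF \<nu>, of "topspace X"]
    by (simp add: ennreal_mult_less_top)
  show "add_scaled X \<mu> c \<nu> F \<le> add_scaled X \<mu> c \<nu> U"
    if "closedin X F" "openin X U" "F \<subseteq> U" for F U
    using that by (auto intro!: add_mono mult_left_mono DTM_mono[OF \<mu>] DTM_mono[OF \<nu>])
  show "add_scaled X \<mu> c \<nu> (C \<union> K) = add_scaled X \<mu> c \<nu> C + add_scaled X \<mu> c \<nu> K"
    if "compactin X C" "compactin X K" "C \<inter> K = {}" for C K
    using that
    by (simp add: compactin_imp_closedin[OF H] compactin_Un DTM_compact_Un[OF \<mu>]
        DTM_compact_Un[OF \<nu>] distrib_left ac_simps)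
  have e': "x + ennreal (e / (1 + c)) + ennreal c * (y + ennreal (e / (1 + c)))
      = x + ennreal c * y + ennreal e" if "0 < e" for x y e
  proof -
    have "e / (1 + c) + c * (e / (1 + c)) = (1 + c) * (e / (1 + c))"
      by (simp only: distrib_right mult_1_left)
    also have "\<dots> = e" using c by simp
    finally have "ennreal (e / (1 + c)) + ennreal c * ennreal (e / (1 + c)) = ennreal e"
      using that c by (simp flip: ennreal_mult ennreal_plus)
    then show ?thesis
      by (simp add: distrib_left ac_simps)
  qed
  show "\<exists>K. compactin X K \<and> K \<subseteq> U \<and> add_scaled X \<mu> c \<nu> U \<le> add_scaled X \<mu> c \<nu> K + ennreal e"
    if U: "openin X U" and e: "0 < e" for U e
  proof -
    (* An error of e / (1 + c) for each of \<mu> and \<nu> adds up to e in \<mu> + c \<nu>. *)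
    have pos: "0 < e / (1 + c)" using e c by auto
    obtain K1 where K1: "compactin X K1" "K1 \<subseteq> U" "\<mu> U \<le> \<mu> K1 + ennreal (e / (1 + c))"
      using DTM_inner[OF \<mu> U pos] by auto
    obtain K2 where K2: "compactin X K2" "K2 \<subseteq> U" "\<nu> U \<le> \<nu> K2 + ennreal (e / (1 + c))"
      using DTM_inner[OF \<nu> U pos] by auto
    have K: "compactin X (K1 \<union> K2)" using K1 K2 by (simp add: compactin_Un)
    have "\<mu> K1 \<le> \<mu> (K1 \<union> K2)" "\<nu> K2 \<le> \<nu> (K1 \<union> K2)"
      using K K1 K2 by (auto intro!: DTM_mono[OF \<mu>] DTM_mono[OF \<nu>] closed_in_open_or_closed
          compactin_imp_closedin[OF H])
    then have "\<mu> U + ennreal c * \<nu> U \<le> \<mu> (K1 \<union> K2) + ennreal (e / (1 + c))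
        + ennreal c * (\<nu> (K1 \<union> K2) + ennreal (e / (1 + c)))"
      using K1(3) K2(3) by (intro add_mono mult_left_mono) (auto intro: order_trans add_right_mono)
    then show ?thesis
      using K K1 K2 U
      by (intro exI[of _ "K1 \<union> K2"]) (simp add: e'[OF e] compactin_imp_closedin[OF H])
  qed
  show "\<exists>U. openin X U \<and> F \<subseteq> U \<and> add_scaled X \<mu> c \<nu> U \<le> add_scaled X \<mu> c \<nu> F + ennreal e"
    if F: "closedin X F" and e: "0 < e" for F e
  proof -
    have pos: "0 < e / (1 + c)" using e c by auto
    obtain U1 where U1: "openin X U1" "F \<subseteq> U1" "\<mu> U1 \<le> \<mu> F + ennreal (e / (1 + c))"
      using DTM_outer[OF \<mu> F pos] by auto
    obtain U2 where U2: "openin X U2" "F \<subseteq> U2" "\<nu> U2 \<le> \<nu> F + ennreal (e / (1 + c))"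
      using DTM_outer[OF \<nu> F pos] by auto
    have U: "openin X (U1 \<inter> U2)" using U1 U2 by auto
    have "\<mu> (U1 \<inter> U2) \<le> \<mu> U1" "\<nu> (U1 \<inter> U2) \<le> \<nu> U2"
      using U U1 U2 by (auto intro!: DTM_mono[OF \<mu>] DTM_mono[OF \<nu>])
    then have "\<mu> (U1 \<inter> U2) + ennreal c * \<nu> (U1 \<inter> U2) \<le> \<mu> F + ennreal (e / (1 + c))
        + ennreal c * (\<nu> F + ennreal (e / (1 + c)))"
      using U1(3) U2(3) by (intro add_mono mult_left_mono) auto
    then show ?thesis
      using U U1 U2 F by (intro exI[of _ "U1 \<inter> U2"]) (simp add: e'[OF e])
  qed
qed (simp add: add_scaled_def)

lemma add_scaled_in_TM:
  assumes H: "Hausdorff_space X" and \<mu>: "\<mu> \<in> TM X" and \<nu>: "\<nu> \<in> TM X" and c: "0 \<le> c"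
  shows "add_scaled X \<mu> c \<nu> \<in> TM X"
proof -
  have ooc: "A \<in> open_or_closed X" if "compactin X A \<or> openin X A" for A
    using that compactin_imp_closedin[OF H] by auto
  have "add_scaled X \<mu> c \<nu> (A \<union> B) = add_scaled X \<mu> c \<nu> A + add_scaled X \<mu> c \<nu> B"
    if "compactin X A \<or> openin X A" "compactin X B \<or> openin X B"
      "compactin X (A \<union> B) \<or> openin X (A \<union> B)" "A \<inter> B = {}" for A B
    by (simp only: add_scaled_apply[OF ooc] that TM_additive[OF \<mu> that] TM_additive[OF \<nu> that]
        distrib_left ac_simps)
  then show ?thesis
    using assms add_scaled_in_DTM[OF H, of \<mu> \<nu> c] by (simp add: TM_iff)
qed

lemma add_scaled_in_Meas:
  assumes H: "Hausdorff_space X" and \<mu>: "\<mu> \<in> Meas X" and \<nu>: "\<nu> \<in> Meas X" and c: "0 \<le> c"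
  shows "add_scaled X \<mu> c \<nu> \<in> Meas X"
proof -
  have "\<mu> (U \<union> V) + ennreal c * \<nu> (U \<union> V) \<le> (\<mu> U + ennreal c * \<nu> U) + (\<mu> V + ennreal c * \<nu> V)"
    if "openin X U" "openin X V" for U V
  proof -
    have "\<mu> (U \<union> V) + ennreal c * \<nu> (U \<union> V) \<le> (\<mu> U + \<mu> V) + ennreal c * (\<nu> U + \<nu> V)"
      using \<mu> \<nu> that unfolding Meas_iff_subadditive[OF H] subadditive_on_open_def
      by (intro add_mono mult_left_mono) auto
    then show ?thesis
      by (simp add: distrib_left ac_simps)
  qed
  then show ?thesis
    using \<mu> \<nu> c unfolding Meas_iff_subadditive[OF H]
    by (auto simp: add_scaled_in_DTM[OF H] subadditive_on_open_def openin_Un)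
qed

text \<open>Both \<open>\<mu>\<close> and \<open>\<mu> + c \<nu>\<close> satisfy the inclusion-exclusion identity on open sets. Subtracting the two
finite identities and dividing by \<open>c\<close> gives it for \<open>\<nu>\<close>, and hence subadditivity.\<close>

lemma Meas_if_add_scaled_Meas:
  assumes H: "Hausdorff_space X" and \<mu>: "\<mu> \<in> Meas X" and \<nu>: "\<nu> \<in> DTM X" and c: "0 < c"
    and sum: "add_scaled X \<mu> c \<nu> \<in> Meas X"
  shows "\<nu> \<in> Meas X"
proof -
  have "\<nu> (U \<union> V) \<le> \<nu> U + \<nu> V" if U: "openin X U" and V: "openin X V" for U V
  proof -
    have o: "openin X (U \<union> V)" "openin X (U \<inter> V)" using U V by auto
    note modular = Meas_modular[OF \<mu> U V] Meas_modular[OF sum U V]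
    have fin: "\<mu> (U \<union> V) + \<mu> (U \<inter> V) \<noteq> top"
      using \<mu> o DTM_finite[of \<mu> X] unfolding Meas_iff_subadditive[OF H] by (simp add: less_top)
    let ?s = "add_scaled X \<mu> c \<nu>"
    have "(\<mu> (U \<union> V) + \<mu> (U \<inter> V)) + ennreal c * (\<nu> U + \<nu> V) = ?s U + ?s V"
      using U V by (simp add: distrib_left add.assoc add.left_commute flip: modular(1))
    also have "\<dots> = ?s (U \<union> V) + ?s (U \<inter> V)" by (rule modular(2))
    also have "\<dots> = (\<mu> (U \<union> V) + \<mu> (U \<inter> V)) + ennreal c * (\<nu> (U \<union> V) + \<nu> (U \<inter> V))"
      using o by (simp add: distrib_left ac_simps)
    finally have "(\<mu> (U \<union> V) + \<mu> (U \<inter> V)) + ennreal c * (\<nu> U + \<nu> V)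
      = (\<mu> (U \<union> V) + \<mu> (U \<inter> V)) + ennreal c * (\<nu> (U \<union> V) + \<nu> (U \<inter> V))" .
    then have "\<nu> U + \<nu> V = \<nu> (U \<union> V) + \<nu> (U \<inter> V)"
      using fin c by (auto simp: ennreal_add_left_cancel ennreal_mult_cancel_left)
    then show ?thesis by simp
  qed
  then show ?thesis
    using \<nu> by (auto simp: Meas_iff_subadditive[OF H] subadditive_on_open_def)
qed

lemma zero_in_Meas:
  assumes H: "Hausdorff_space X" shows "(\<lambda>A\<in>open_or_closed X. 0) \<in> Meas X"
  unfolding Meas_iff_subadditive[OF H]
proof
  show "(\<lambda>A\<in>open_or_closed X. 0) \<in> DTM X"
  proof (rule DTM_by_approximation[OF H])
    show "\<exists>K. compactin X K \<and> K \<subseteq> U \<and> (\<lambda>A\<in>open_or_closed X. 0) U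
        \<le> (\<lambda>A\<in>open_or_closed X. 0::ennreal) K + ennreal e" if "openin X U" for U and e :: real
      using that by (intro exI[of _ "{}"]) auto
    show "\<exists>U. openin X U \<and> F \<subseteq> U \<and> (\<lambda>A\<in>open_or_closed X. 0) U
        \<le> (\<lambda>A\<in>open_or_closed X. 0::ennreal) F + ennreal e" if "closedin X F" for F and e :: real
      using closedin_subset[OF that] by (intro exI[of _ "topspace X"]) auto
  qed (auto simp: compactin_imp_closedin[OF H] compactin_Un)
  show "subadditive_on_open X (\<lambda>A\<in>open_or_closed X. 0)"
    by (simp add: subadditive_on_open_def openin_Un)
qed

section \<open>Subtracting a measure\<close>

definition diff_on ::
  "'a topology \<Rightarrow> ('a set \<Rightarrow> ennreal) \<Rightarrow> ('a set \<Rightarrow> ennreal) \<Rightarrow> ('a set \<Rightarrow> ennreal)" where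
  "diff_on X \<nu> m = (\<lambda>A\<in>open_or_closed X. \<nu> A - m A)"

context
  fixes X :: "'a topology" and \<nu> m :: "'a set \<Rightarrow> ennreal"
  assumes H: "Hausdorff_space X" and \<nu>: "\<nu> \<in> DTM X" and m: "m \<in> Meas X" and le: "m \<le> \<nu>"
begin

lemma diff_on_add: "A \<in> open_or_closed X \<Longrightarrow> m A + diff_on X \<nu> m A = \<nu> A"
  using le by (simp add: diff_on_def le_fun_def add.commute diff_add_cancel_ennreal)

lemma diff_on_le_iff:
  assumes "A \<in> open_or_closed X" shows "diff_on X \<nu> m A \<le> z \<longleftrightarrow> \<nu> A \<le> m A + z"
  using ennreal_add_left_cancel_le[of "m A" "diff_on X \<nu> m A" z] DTM_finite[OF Meas_imp_DTM[OF H m] assms]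
  by (auto simp: diff_on_add[OF assms])

lemma diff_on_Un:
  assumes A: "A \<in> open_or_closed X" and B: "B \<in> open_or_closed X" and AB: "A \<union> B \<in> open_or_closed X"
    and add: "\<nu> (A \<union> B) = \<nu> A + \<nu> B" "m (A \<union> B) = m A + m B"
  shows "diff_on X \<nu> m (A \<union> B) = diff_on X \<nu> m A + diff_on X \<nu> m B"
proof -
  let ?d = "diff_on X \<nu> m"
  have "m (A \<union> B) + ?d (A \<union> B) = (m A + ?d A) + (m B + ?d B)"
    by (simp only: diff_on_add[OF A] diff_on_add[OF B] diff_on_add[OF AB] add(1))
  also have "\<dots> = m (A \<union> B) + (?d A + ?d B)"
    by (simp add: add ac_simps)
  finally show ?thesis
    using DTM_finite[OF Meas_imp_DTM[OF H m] AB] by (auto simp: ennreal_add_left_cancel)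
qed

text \<open>The point is monotonicity. For closed \<open>F \<subseteq> U\<close> with \<open>U\<close> open, superadditivity of \<open>\<nu>\<close> gives
\<open>\<nu> F + m (U - F) \<le> \<nu> F + \<nu> (U - F) \<le> \<nu> U\<close>, whereas \<open>m\<close> is additive on this decomposition of \<open>U\<close>.
The approximation properties come from sets that approximate \<open>\<nu>\<close> alone, since \<open>m\<close> is monotone.\<close>

lemma diff_on_in_DTM: "diff_on X \<nu> m \<in> DTM X"
proof (rule DTM_by_approximation[OF H])
  let ?d = "diff_on X \<nu> m"
  have dle: "?d A \<le> \<nu> A" if "A \<in> open_or_closed X" for A
    using that by (simp add: diff_on_le_iff)
  show "?d (topspace X) < top"
    using le_less_trans[OF dle DTM_finite[OF \<nu>]] by simp
  show "?d F \<le> ?d U" if F: "closedin X F" and U: "openin X U" and "F \<subseteq> U" for F U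
  proof -
    have UF: "openin X (U - F)" using F U by auto
    have "m (U - F) + \<nu> F \<le> \<nu> (U - F) + \<nu> F"
      using le by (intro add_right_mono) (auto simp: le_fun_def)
    also have "\<dots> \<le> \<nu> U"
      using DTM_superadditive[OF \<nu> H F U \<open>F \<subseteq> U\<close>] by (simp add: add.commute)
    also have "\<dots> = m (U - F) + (m F + ?d U)"
      using Meas_closed_open_add[OF m F U \<open>F \<subseteq> U\<close>] diff_on_add[of U] U
      by (metis add.assoc add.commute open_in_open_or_closed)
    finally show ?thesis
      using F UF DTM_finite[OF Meas_imp_DTM[OF H m], of "U - F"]
      by (auto simp: diff_on_le_iff ennreal_add_left_cancel_le)
  qed
  show "?d (C \<union> K) = ?d C + ?d K"
    if "compactin X C" "compactin X K" "C \<inter> K = {}" for C K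
    using that(1,2) compactin_imp_closedin[OF H] compactin_Un[OF that(1,2)]
      DTM_compact_Un[OF \<nu> that] DTM_compact_Un[OF Meas_imp_DTM[OF H m] that]
    by (intro diff_on_Un) auto
  show "\<exists>K. compactin X K \<and> K \<subseteq> U \<and> ?d U \<le> ?d K + ennreal e"
    if U: "openin X U" and e: "0 < e" for U e
  proof -
    obtain K where K: "compactin X K" "K \<subseteq> U" "\<nu> U \<le> \<nu> K + ennreal e"
      using DTM_inner[OF \<nu> U e] by auto
    have cK: "closedin X K" using compactin_imp_closedin[OF H K(1)] .
    have "\<nu> K + ennreal e = m K + (?d K + ennreal e)"
      using cK by (simp add: diff_on_add flip: add.assoc)
    also have "\<dots> \<le> m U + (?d K + ennreal e)"
      using K cK U by (intro add_right_mono DTM_mono[OF Meas_imp_DTM[OF H m]]) auto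
    finally show ?thesis
      using K U by (intro exI[of _ K]) (auto simp: diff_on_le_iff intro: order_trans)
  qed
  show "\<exists>U. openin X U \<and> F \<subseteq> U \<and> ?d U \<le> ?d F + ennreal e"
    if F: "closedin X F" and e: "0 < e" for F e
  proof -
    obtain U where U: "openin X U" "F \<subseteq> U" "\<nu> U \<le> \<nu> F + ennreal e"
      using DTM_outer[OF \<nu> F e] by auto
    have "\<nu> F + ennreal e = m F + (?d F + ennreal e)"
      using F by (simp add: diff_on_add flip: add.assoc)
    also have "\<dots> \<le> m U + (?d F + ennreal e)"
      using U F by (intro add_right_mono DTM_mono[OF Meas_imp_DTM[OF H m]]) auto
    finally show ?thesis
      using U by (intro exI[of _ U]) (auto simp: diff_on_le_iff intro: order_trans)
  qed
qed (simp add: diff_on_def)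

lemma diff_on_in_TM:
  assumes "\<nu> \<in> TM X" shows "diff_on X \<nu> m \<in> TM X"
proof -
  have "diff_on X \<nu> m (A \<union> B) = diff_on X \<nu> m A + diff_on X \<nu> m B"
    if "compactin X A \<or> openin X A" "compactin X B \<or> openin X B"
      "compactin X (A \<union> B) \<or> openin X (A \<union> B)" "A \<inter> B = {}" for A B
    using that(1-3) compactin_imp_closedin[OF H] TM_additive[OF assms that] TM_additive[OF Meas_imp_TM[OF H m] that]
    by (intro diff_on_Un) auto
  then show ?thesis
    using diff_on_in_DTM by (simp add: TM_iff)
qed

end

section \<open>Maximal measures and the proper part\<close>

text \<open>Outer regularity is the one property that a pointwise supremum could destroy. Choose \<open>l\<close> in the
chain almost exhausting the total mass of the supremum. A larger member \<open>k\<close> dominates \<open>l\<close> on the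
closed complement of \<open>U\<close>, and both measures split the total mass between \<open>U\<close> and this complement; so
\<open>k\<close> exceeds \<open>l\<close> on \<open>U\<close> by no more than the small total excess. Hence an open set that is good for \<open>l\<close> is good for every member of the chain.\<close>

lemma SUP_chain_in_Meas:
  fixes C :: "('a set \<Rightarrow> ennreal) set"
  assumes H: "Hausdorff_space X" and CM: "C \<subseteq> Meas X" and ne: "C \<noteq> {}"
    and chain: "\<And>l k. l \<in> C \<Longrightarrow> k \<in> C \<Longrightarrow> l \<le> k \<or> k \<le> l"
    and \<nu>: "\<nu> \<in> DTM X" and le: "\<And>l. l \<in> C \<Longrightarrow> l \<le> \<nu>"
  shows "(\<lambda>A\<in>open_or_closed X. SUP l\<in>C. l A) \<in> Meas X"
proof -
  define \<sigma> where "\<sigma> = (\<lambda>A\<in>open_or_closed X. SUP l\<in>C. l A)"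
  have \<sigma>: "\<sigma> A = (SUP l\<in>C. l A)" if "A \<in> open_or_closed X" for A
    using that by (simp add: \<sigma>_def)
  have DTM: "l \<in> DTM X" and sub: "subadditive_on_open X l" if "l \<in> C" for l
    using CM that Meas_iff_subadditive[OF H] by auto
  have upper: "l A \<le> \<sigma> A" if "l \<in> C" "A \<in> open_or_closed X" for l A
    using that by (auto simp: \<sigma> intro: SUP_upper)
  have fin: "\<sigma> A < top" if "A \<in> open_or_closed X" for A
  proof -
    have "\<sigma> A \<le> \<nu> A" using le that by (auto simp: \<sigma> le_fun_def intro: SUP_least)
    then show ?thesis using DTM_finite[OF \<nu> that] by (rule le_less_trans)
  qed
  have approx: "\<exists>l\<in>C. \<sigma> A \<le> l A + ennreal e" if "A \<in> open_or_closed X" "0 < e" for A e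
  proof -
    have "\<exists>l\<in>C. \<sigma> A < l A + ennreal e"
      using fin[OF that(1)] by (intro SUP_approx_ennreal[OF that(2) ne \<sigma>[OF that(1)]]) auto
    then show ?thesis by (auto intro: less_imp_le)
  qed
  have "\<sigma> \<in> DTM X"
  proof (rule DTM_by_approximation[OF H])
    show "\<sigma> (topspace X) < top" by (simp add: fin)
    show "\<sigma> F \<le> \<sigma> U" if "closedin X F" "openin X U" "F \<subseteq> U" for F U
      using that by (simp add: \<sigma>) (intro SUP_subset_mono order_refl DTM_mono[OF DTM]; simp)
    show "\<sigma> (B \<union> K) = \<sigma> B + \<sigma> K" if BK: "compactin X B" "compactin X K" "B \<inter> K = {}" for B K
    proof -
      have "(SUP l\<in>C. l (B \<union> K)) = (SUP l\<in>C. l B + l K)"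
        using BK by (intro SUP_cong refl DTM_compact_Un[OF DTM])
      also have "\<dots> = (SUP l\<in>C. l B) + (SUP l\<in>C. l K)"
      proof (rule SUP_add_directed_ennreal)
        fix l k assume lk: "l \<in> C" "k \<in> C"
        then show "\<exists>j\<in>C. l B + k K \<le> j B + j K"
          using chain[OF lk] by (auto simp: le_fun_def intro: add_mono)
      qed
      finally show ?thesis
        using BK compactin_imp_closedin[OF H] by (simp add: \<sigma> compactin_Un)
    qed
    show "\<exists>K. compactin X K \<and> K \<subseteq> U \<and> \<sigma> U \<le> \<sigma> K + ennreal e" if U: "openin X U" and e: "0 < e" for U e
    proof -
      obtain l where l: "l \<in> C" "\<sigma> U \<le> l U + ennreal (e/2)"
        using approx[of U "e/2"] U e by auto
      obtain K where K: "compactin X K" "K \<subseteq> U" "l U \<le> l K + ennreal (e/2)"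
        using DTM_inner[OF DTM[OF l(1)] U, of "e/2"] e by auto
      have "l K \<le> \<sigma> K" using upper[OF l(1)] compactin_imp_closedin[OF H K(1)] by simp
      then have "\<sigma> U \<le> (\<sigma> K + ennreal (e/2)) + ennreal (e/2)"
        using l K by (meson add_right_mono order_trans)
      with K e show ?thesis
        by (intro exI[of _ K]) (simp add: add.assoc flip: ennreal_plus)
    qed
    show "\<exists>U. openin X U \<and> F \<subseteq> U \<and> \<sigma> U \<le> \<sigma> F + ennreal e" if F: "closedin X F" and e: "0 < e" for F e
    proof -
      obtain l where l: "l \<in> C" "\<sigma> (topspace X) \<le> l (topspace X) + ennreal (e/2)"
        using approx[of "topspace X" "e/2"] e by auto
      obtain U where U: "openin X U" "F \<subseteq> U" "l U \<le> l F + ennreal (e/2)"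
        using DTM_outer[OF DTM[OF l(1)] F, of "e/2"] e by auto
      have split: "k (topspace X - U) + k U = k (topspace X)" if "k \<in> C" for k
        using Meas_closed_open_add[of k X "topspace X - U" "topspace X"] that CM U openin_subset[OF U(1)]
        by (auto simp: double_diff)
      have "k U \<le> \<sigma> F + ennreal e" if k: "k \<in> C" for k
      proof -
        (* For k above l, the common complement of U is cancelled from the two total masses. *)
        have "k U \<le> l F + ennreal e"
          using chain[OF k l(1)]
        proof
          assume "k \<le> l"
          then have "k U \<le> l F + ennreal (e/2)"
            using U(3) by (meson le_fun_def order_trans)
          also have "\<dots> \<le> l F + ennreal e" using e by (intro add_left_mono) (auto intro: ennreal_leI)
          finally show ?thesis .
        next
          assume lk: "l \<le> k"
          have "k (topspace X - U) + k U \<le> l (topspace X) + ennreal (e/2)"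
            using upper[OF k, of "topspace X"] l(2) by (simp add: split[OF k])
          also have "\<dots> = (l (topspace X - U) + l U) + ennreal (e/2)"
            by (simp add: split[OF l(1)])
          also have "\<dots> \<le> (k (topspace X - U) + (l F + ennreal (e/2))) + ennreal (e/2)"
            using lk U(3) by (intro add_mono) (auto simp: le_fun_def)
          also have "\<dots> = k (topspace X - U) + (l F + ennreal e)"
            using e by (simp add: add.assoc flip: ennreal_plus)
          finally show ?thesis
            using DTM_finite[OF DTM[OF k], of "topspace X - U"] closedin_diff[OF closedin_topspace U(1)]
            by (auto simp: ennreal_add_left_cancel_le)
        qed
        also have "\<dots> \<le> \<sigma> F + ennreal e"
          using upper[OF l(1)] F by (intro add_right_mono) auto
        finally show ?thesis .
      qed
      then show ?thesis
        using U by (intro exI[of _ U]) (auto simp: \<sigma>[of U] intro!: SUP_least)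
    qed
  qed (simp add: \<sigma>_def)
  moreover have "subadditive_on_open X \<sigma>"
    unfolding subadditive_on_open_def
  proof (intro allI impI)
    fix U V assume UV: "openin X U" "openin X V"
    have "l (U \<union> V) \<le> \<sigma> U + \<sigma> V" if l: "l \<in> C" for l
    proof -
      have "l (U \<union> V) \<le> l U + l V"
        using sub[OF l] UV by (auto simp: subadditive_on_open_def)
      also have "\<dots> \<le> \<sigma> U + \<sigma> V"
        using UV by (intro add_mono upper[OF l]) auto
      finally show ?thesis .
    qed
    then show "\<sigma> (U \<union> V) \<le> \<sigma> U + \<sigma> V"
      using UV by (auto simp: \<sigma>[of "U \<union> V"] openin_Un intro: SUP_least)
  qed
  ultimately show ?thesis
    by (simp add: Meas_iff_subadditive[OF H] \<sigma>_def)
qed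

lemma maximal_Meas_below:
  assumes H: "Hausdorff_space X" and \<nu>: "\<nu> \<in> DTM X"
  obtains m where "m \<in> Meas X" "m \<le> \<nu>" "\<And>m'. \<lbrakk>m' \<in> Meas X; m' \<le> \<nu>; m \<le> m'\<rbrakk> \<Longrightarrow> m' = m"
proof -
  let ?A = "{m \<in> Meas X. m \<le> \<nu>}"
  have leI: "l \<le> \<nu>" if "\<And>A. A \<in> open_or_closed X \<Longrightarrow> l A \<le> \<nu> A"
    "l \<in> extensional (open_or_closed X)" for l
    using that DTM_extensional[OF \<nu>]
    by (auto simp: le_fun_def extensional_def) (metis order_refl)
  have "\<exists>m\<in>?A. \<forall>a\<in>?A. m \<le> a \<longrightarrow> a = m"
  proof (rule predicate_Zorn)
    show "partial_order_on ?A (relation_of (\<le>) ?A)"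
      by (rule partial_order_on_relation_ofI) auto
    fix C assume C: "C \<in> Chains (relation_of (\<le>) ?A)"
    then have CA: "l \<in> ?A" if "l \<in> C" for l
      using that by (auto simp: Chains_def relation_of_def)
    have chain: "l \<le> k \<or> k \<le> l" if "l \<in> C" "k \<in> C" for l k
      using C that by (auto simp: Chains_def relation_of_def)
    show "\<exists>u\<in>?A. \<forall>a\<in>C. a \<le> u"
    proof (cases "C = {}")
      case True
      then show ?thesis
        using zero_in_Meas[OF H] by (intro bexI[of _ "\<lambda>A\<in>open_or_closed X. 0"]) (auto intro: leI)
    next
      case False
      let ?s = "\<lambda>A\<in>open_or_closed X. SUP l\<in>C. l A"
      have "?s \<in> Meas X"
        using CA chain by (intro SUP_chain_in_Meas[OF H _ False _ \<nu>]) auto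
      moreover have "?s \<le> \<nu>"
      proof (rule leI)
        show "?s A \<le> \<nu> A" if "A \<in> open_or_closed X" for A
          using CA that by (auto intro!: SUP_least simp: le_fun_def)
      qed simp
      moreover have "l \<le> ?s" if l: "l \<in> C" for l
      proof (rule le_funI)
        fix A
        have "l \<in> extensional (open_or_closed X)"
          using CA[OF l] by (auto elim: Meas_obtain)
        then show "l A \<le> ?s A"
          using l by (auto simp: extensional_def restrict_def intro: SUP_upper)
      qed
      ultimately show ?thesis by blast
    qed
  qed
  with that show thesis by blast
qed

text \<open>For a maximal measure \<open>m \<le> \<nu>\<close>, a Radon measure \<open>r \<le> \<nu> - m\<close> would make \<open>m + r\<close> a measure between \<open>m\<close>
and \<open>\<nu>\<close>; so \<open>m + r = m\<close> and \<open>r = 0\<close>. If \<open>\<nu> - m\<close> vanished, \<open>\<nu> = m\<close> would be a measure.\<close>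

lemma exists_nonzero_proper:
  assumes H: "Hausdorff_space X" and \<nu>: "\<nu> \<in> DTM X" and "\<nu> \<notin> Meas X"
  obtains m where "m \<in> Meas X" "m \<le> \<nu>" "nonzero X (diff_on X \<nu> m)" "proper X (diff_on X \<nu> m)"
proof -
  obtain m where m: "m \<in> Meas X" "m \<le> \<nu>"
    and max: "\<And>m'. \<lbrakk>m' \<in> Meas X; m' \<le> \<nu>; m \<le> m'\<rbrakk> \<Longrightarrow> m' = m"
    using maximal_Meas_below[OF H \<nu>] by blast
  note add = diff_on_add[OF H \<nu> m]
  note DTM = Meas_imp_DTM[OF H m(1)]
  have "nonzero X (diff_on X \<nu> m)"
  proof (rule ccontr)
    assume "\<not> ?thesis"
    then have "m A = \<nu> A" if "A \<in> open_or_closed X" for A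
      using add[OF that] that by (auto simp: nonzero_def)
    then have "m = \<nu>"
      by (intro extensionalityI[OF DTM_extensional[OF DTM] DTM_extensional[OF \<nu>]])
    with m \<open>\<nu> \<notin> Meas X\<close> show False by simp
  qed
  moreover have "proper X (diff_on X \<nu> m)"
    unfolding proper_def
  proof (intro allI impI ballI, elim conjE)
    fix r A assume r: "radon_measure_on X r"
      and le: "\<forall>A\<in>open_or_closed X. emeasure r A \<le> diff_on X \<nu> m A" and A: "A \<in> sets r"
    let ?r = "restrict (emeasure r) (open_or_closed X)"
    have space: "space r = topspace X" and reg: "regular_borel_measure_on X r"
      using r by (auto simp: radon_measure_on_def regular_borel_measure_on_def borel_measure_on_def)
    have "emeasure r (topspace X) < top"
      using le DTM_finite[OF diff_on_in_DTM[OF H \<nu> m], of "topspace X"]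
      by (auto intro: le_less_trans)
    then have "finite_measure r"
      by (intro finite_measureI) (simp add: space)
    then have rM: "?r \<in> Meas X" using reg by (auto simp: Meas_def)
    let ?s = "add_scaled X m 1 ?r"
    have s: "?s A \<le> \<nu> A \<and> m A \<le> ?s A" if "A \<in> open_or_closed X" for A
      using add[OF that] le that by (auto simp flip: add intro!: add_left_mono)
    have "?s A \<le> \<nu> A \<and> m A \<le> ?s A" for A
    proof (cases "A \<in> open_or_closed X")
      case False
      then show ?thesis
        using DTM_extensional[OF DTM] DTM_extensional[OF \<nu>]
        by (simp add: extensional_def add_scaled_def)
    qed (rule s)
    then have "?s \<le> \<nu>" "m \<le> ?s"
      by (simp_all add: le_fun_def)
    then have eq: "?s = m"
      using max add_scaled_in_Meas[OF H m(1) rM, of 1] by simp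
    have "m (topspace X) + emeasure r (topspace X) = m (topspace X)"
      using fun_cong[OF eq, of "topspace X"] by simp
    then have "emeasure r (space r) = 0"
      using DTM_finite[OF DTM, of "topspace X"]
      by (metis add.right_neutral ennreal_add_left_cancel less_top open_in_open_or_closed
          openin_topspace infinity_ennreal_def space order_less_irrefl)
    then show "emeasure r A = 0"
      using emeasure_space[of r A] by simp
  qed
  ultimately show thesis using m that by blast
qed

lemma Meas_proper_imp_zero:
  assumes H: "Hausdorff_space X" and "\<nu> \<in> Meas X" "proper X \<nu>"
  shows "\<not> nonzero X \<nu>"
proof -
  from assms(2) obtain m where m: "regular_borel_measure_on X m" "finite_measure m"
    "\<And>A. A \<in> open_or_closed X \<Longrightarrow> \<nu> A = emeasure m A" "open_or_closed X \<subseteq> sets m"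
    by (rule Meas_obtain) blast
  then have "radon_measure_on X m"
    by (auto simp: radon_measure_on_def less_top[symmetric] finite_measure.emeasure_finite)
  moreover have "\<forall>A\<in>open_or_closed X. emeasure m A \<le> \<nu> A"
    by (simp add: m(3))
  ultimately have "\<forall>A\<in>sets m. emeasure m A = 0"
    using assms(3) unfolding proper_def by blast
  then have "\<nu> A = 0" if "A \<in> open_or_closed X" for A
    using m(3)[OF that] subsetD[OF m(4) that] by simp
  then show ?thesis by (simp add: nonzero_def)
qed

section \<open>Integrals of functions vanishing at infinity\<close>

lemma superlevel_open:
  assumes "f \<in> C0_plus X" shows "openin X {x \<in> topspace X. t < f x}"
  using assms openin_continuous_map_preimage[of X euclideanreal f "{t<..}"]
  by (simp add: C0_plus_def)

lemma C0_plus_bounded: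
  assumes f: "f \<in> C0_plus X" obtains b where "0 \<le> b" "\<And>x. x \<in> topspace X \<Longrightarrow> f x \<le> b"
proof -
  have "\<forall>\<epsilon>>0. \<exists>K. compactin X K \<and> (\<forall>x\<in>topspace X - K. f x < \<epsilon>)"
    using f by (simp add: C0_plus_def)
  then obtain K where K: "compactin X K" "\<And>x. x \<in> topspace X - K \<Longrightarrow> f x < 1"
    using zero_less_one by blast
  have "compactin euclideanreal (f ` K)"
    using f K by (intro image_compactin) (auto simp: C0_plus_def)
  then have "bounded (f ` K)"
    by (simp add: compact_imp_bounded)
  then obtain b where b: "\<And>x. x \<in> K \<Longrightarrow> \<bar>f x\<bar> \<le> b"
    by (auto simp: bounded_iff)
  show thesis
  proof
    show "0 \<le> max 1 b" by simp
    show "f x \<le> max 1 b" if "x \<in> topspace X" for x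
      using b[of x] K(2)[of x] that by (cases "x \<in> K") auto
  qed
qed

lemma max_in_C0_plus:
  assumes f: "f \<in> C0_plus X" and g: "g \<in> C0_plus X"
  shows "(\<lambda>x. max (f x) (g x)) \<in> C0_plus X"
  unfolding C0_plus_def
proof (intro CollectI conjI allI impI)
  show "continuous_map X euclideanreal (\<lambda>x. max (f x) (g x))"
    using f g by (intro continuous_map_real_max) (auto simp: C0_plus_def)
  show "\<forall>x\<in>topspace X. 0 \<le> max (f x) (g x)"
    using f by (auto simp: C0_plus_def le_max_iff_disj)
  fix e :: real assume e: "0 < e"
  obtain K where K: "compactin X K" "\<forall>x \<in> topspace X - K. f x < e"
    using f e by (auto simp: C0_plus_def)
  obtain L where L: "compactin X L" "\<forall>x \<in> topspace X - L. g x < e"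
    using g e by (auto simp: C0_plus_def)
  show "\<exists>K. compactin X K \<and> (\<forall>x\<in>topspace X - K. max (f x) (g x) < e)"
    using K L by (intro exI[of _ "K \<union> L"]) (auto intro: compactin_Un)
qed

context
  fixes X :: "'a topology" and \<nu> :: "'a set \<Rightarrow> ennreal"
  assumes \<nu>: "\<nu> \<in> DTM X"
begin

lemma superlevel_measurable:
  assumes f: "f \<in> C0_plus X"
  shows "(\<lambda>t. \<nu> {x \<in> topspace X. t < f x}) \<in> borel_measurable lborel"
proof -
  let ?h = "\<lambda>t. \<nu> {x \<in> topspace X. t < f x}"
  have fin: "?h t < top" for t
    using superlevel_open[OF f] by (intro DTM_finite[OF \<nu>]) auto
  have "mono (\<lambda>t. - enn2real (?h t))"
  proof (rule monoI)
    fix s t :: real assume "s \<le> t"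
    then have "?h t \<le> ?h s"
      using superlevel_open[OF f] by (intro DTM_mono[OF \<nu>]) auto
    then show "- enn2real (?h s) \<le> - enn2real (?h t)"
      using fin by (simp add: enn2real_mono)
  qed
  then have "(\<lambda>t. - enn2real (?h t)) \<in> borel_measurable borel"
    by (rule borel_measurable_mono)
  then have "(\<lambda>t. ennreal (- (- enn2real (?h t)))) \<in> borel_measurable borel"
    by measurable
  then show ?thesis
    using fin by simp
qed

lemma superlevel_integral_finite:
  assumes f: "f \<in> C0_plus X"
  shows "(\<integral>\<^sup>+ t \<in> {0..}. \<nu> {x \<in> topspace X. t < f x} \<partial>lborel) < top"
proof -
  obtain b where b: "0 \<le> b" "\<And>x. x \<in> topspace X \<Longrightarrow> f x \<le> b"
    using C0_plus_bounded[OF f] by blast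
  have "(\<integral>\<^sup>+ t \<in> {0..}. \<nu> {x \<in> topspace X. t < f x} \<partial>lborel)
      \<le> (\<integral>\<^sup>+ t. \<nu> (topspace X) * indicator {0..b} t \<partial>lborel)"
  proof (rule nn_integral_mono)
    fix t :: real
    show "\<nu> {x \<in> topspace X. t < f x} * indicator {0..} t \<le> \<nu> (topspace X) * indicator {0..b} t"
    proof (cases "t \<le> b")
      case True
      then show ?thesis
        using superlevel_open[OF f, of t]
        by (auto simp: indicator_def intro!: DTM_le_topspace[OF \<nu>])
    next
      case False
      then have "{x \<in> topspace X. t < f x} = {}" using b by force
      then show ?thesis by (simp only: DTM_empty[OF \<nu>] mult_zero_left zero_le)
    qed
  qed
  also have "\<dots> < top"
    using b DTM_finite[OF \<nu>, of "topspace X"] by (simp add: nn_integral_cmult_indicator ennreal_mult_less_top)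
  finally show ?thesis .
qed

text \<open>The maximum is used where one would expect the sum \<open>f + g\<close>: its superlevel set is the union of those
of \<open>f\<close> and \<open>g\<close>, so subadditivity can be applied level by level, without identifying the integral with
a Lebesgue integral.\<close>

lemma dtm_integral_max_le:
  assumes sub: "subadditive_on_open X \<nu>" and f: "f \<in> C0_plus X" and g: "g \<in> C0_plus X"
  shows "dtm_integral X \<nu> (\<lambda>x. max (f x) (g x)) \<le> dtm_integral X \<nu> f + dtm_integral X \<nu> g"
proof -
  have "\<nu> {x \<in> topspace X. t < max (f x) (g x)}
      \<le> \<nu> {x \<in> topspace X. t < f x} + \<nu> {x \<in> topspace X. t < g x}" for t
  proof -
    have "{x \<in> topspace X. t < max (f x) (g x)}
        = {x \<in> topspace X. t < f x} \<union> {x \<in> topspace X. t < g x}" by auto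
    then show ?thesis
      using sub superlevel_open[OF f, of t] superlevel_open[OF g, of t]
      unfolding subadditive_on_open_def by metis
  qed
  then have "(\<integral>\<^sup>+ t \<in> {0..}. \<nu> {x \<in> topspace X. t < max (f x) (g x)} \<partial>lborel)
      \<le> (\<integral>\<^sup>+ t. \<nu> {x \<in> topspace X. t < f x} * indicator {0..} t
             + \<nu> {x \<in> topspace X. t < g x} * indicator {0..} t \<partial>lborel)"
    by (intro nn_integral_mono) (auto simp: indicator_def)
  also have "\<dots> = (\<integral>\<^sup>+ t \<in> {0..}. \<nu> {x \<in> topspace X. t < f x} \<partial>lborel)
      + (\<integral>\<^sup>+ t \<in> {0..}. \<nu> {x \<in> topspace X. t < g x} \<partial>lborel)"
    using superlevel_measurable[OF f] superlevel_measurable[OF g]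
    by (intro nn_integral_add borel_measurable_times_ennreal) auto
  finally show ?thesis
    using superlevel_integral_finite[OF f] superlevel_integral_finite[OF g]
    unfolding dtm_integral_def
    by (subst enn2real_plus[symmetric]) (auto intro!: enn2real_mono)
qed

lemma dtm_integral_le_open:
  assumes f: "f \<in> C0_plus X" and f1: "\<And>x. x \<in> topspace X \<Longrightarrow> f x \<le> 1" and U: "openin X U"
    and fU: "\<And>x. x \<in> topspace X - U \<Longrightarrow> f x = 0"
  shows "dtm_integral X \<nu> f \<le> enn2real (\<nu> U)"
proof -
  have "(\<integral>\<^sup>+ t \<in> {0..}. \<nu> {x \<in> topspace X. t < f x} \<partial>lborel) \<le> (\<integral>\<^sup>+ t. \<nu> U * indicator {0..1::real} t \<partial>lborel)"
  proof (rule nn_integral_mono)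
    fix t :: real
    show "\<nu> {x \<in> topspace X. t < f x} * indicator {0..} t \<le> \<nu> U * indicator {0..1} t"
    proof (cases "0 \<le> t \<and> t \<le> 1")
      case True
      then have "{x \<in> topspace X. t < f x} \<subseteq> U" using fU by force
      then show ?thesis
        using True superlevel_open[OF f, of t] U by (auto intro!: DTM_mono[OF \<nu>])
    next
      case False
      then have "indicator {0..} t = (0::ennreal) \<or> {x \<in> topspace X. t < f x} = {}" using f1 by force
      then show ?thesis
        by (metis DTM_empty[OF \<nu>] mult_zero_left mult_zero_right zero_le)
    qed
  qed
  also have "\<dots> = \<nu> U" by (simp add: nn_integral_cmult_indicator)
  finally show ?thesis
    using DTM_finite[OF \<nu>, of U] U unfolding dtm_integral_def by (intro enn2real_mono) auto
qed

lemma dtm_integral_ge_closed: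
  assumes f: "f \<in> C0_plus X" and K: "closedin X K" and f1: "\<And>x. x \<in> K \<Longrightarrow> 1 \<le> f x"
  shows "enn2real (\<nu> K) \<le> dtm_integral X \<nu> f"
proof -
  have "\<nu> K = (\<integral>\<^sup>+ t. \<nu> K * indicator {0..<1::real} t \<partial>lborel)" by (simp add: nn_integral_cmult_indicator)
  also have "\<dots> \<le> (\<integral>\<^sup>+ t \<in> {0..}. \<nu> {x \<in> topspace X. t < f x} \<partial>lborel)"
  proof (rule nn_integral_mono)
    fix t :: real
    have "\<nu> K \<le> \<nu> {x \<in> topspace X. t < f x}" if "t < 1"
      using that f1 K closedin_subset[OF K] superlevel_open[OF f, of t]
      by (intro DTM_mono[OF \<nu>]) force+
    then show "\<nu> K * indicator {0..<1} t \<le> \<nu> {x \<in> topspace X. t < f x} * indicator {0..} t"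
      by (auto simp: indicator_def)
  qed
  finally show ?thesis
    using superlevel_integral_finite[OF f] unfolding dtm_integral_def by (intro enn2real_mono) auto
qed

end

lemma dtm_integral_add_scaled:
  assumes \<mu>: "\<mu> \<in> DTM X" and \<nu>: "\<nu> \<in> DTM X" and c: "0 \<le> c" and f: "f \<in> C0_plus X"
  shows "dtm_integral X (add_scaled X \<mu> c \<nu>) f = dtm_integral X \<mu> f + c * dtm_integral X \<nu> f"
proof -
  note [measurable] = superlevel_measurable[OF \<mu> f] superlevel_measurable[OF \<nu> f]
  have "(\<integral>\<^sup>+ t \<in> {0..}. add_scaled X \<mu> c \<nu> {x \<in> topspace X. t < f x} \<partial>lborel)
      = (\<integral>\<^sup>+ t. \<mu> {x \<in> topspace X. t < f x} * indicator {0..} t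
             + ennreal c * (\<nu> {x \<in> topspace X. t < f x} * indicator {0..} t) \<partial>lborel)"
    using superlevel_open[OF f] by (intro nn_integral_cong) (auto simp: distrib_right mult.assoc)
  also have "\<dots> = (\<integral>\<^sup>+ t \<in> {0..}. \<mu> {x \<in> topspace X. t < f x} \<partial>lborel)
      + ennreal c * (\<integral>\<^sup>+ t \<in> {0..}. \<nu> {x \<in> topspace X. t < f x} \<partial>lborel)"
    by (subst nn_integral_add) (auto simp: nn_integral_cmult)
  finally show ?thesis
    using superlevel_integral_finite[OF \<mu> f] superlevel_integral_finite[OF \<nu> f] c
    by (simp add: dtm_integral_def enn2real_plus ennreal_mult_less_top enn2real_mult)
qed

text \<open>Local compactness enters through a relatively compact open neighbourhood \<open>W\<close> of \<open>K\<close>: a Urysohn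
function that is zero off \<open>U \<inter> W\<close> has compact support, and thus vanishes at infinity.\<close>

lemma C0_plus_cutoff:
  assumes LC: "locally_compact_space X" and H: "Hausdorff_space X"
    and K: "compactin X K" and U: "openin X U" and "K \<subseteq> U"
  obtains f where "f \<in> C0_plus X" "\<And>x. x \<in> topspace X \<Longrightarrow> f x \<le> 1" "\<And>x. x \<in> K \<Longrightarrow> f x = 1"
    "\<And>x. x \<in> topspace X - U \<Longrightarrow> f x = 0"
proof -
  obtain W L where W: "openin X W" "compactin X L" "K \<subseteq> W" "W \<subseteq> L"
    using LC K H locally_compact_space_compact_closed_compact[of X] by blast
  have "completely_regular_space X"
    using LC H by (auto intro: locally_compact_regular_imp_completely_regular_space)
  moreover have "closedin X (topspace X - (U \<inter> W))"
    using U W by auto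
  moreover have "disjnt K (topspace X - (U \<inter> W))"
    using W \<open>K \<subseteq> U\<close> by (auto simp: disjnt_def)
  ultimately obtain f where f: "continuous_map X (top_of_set {0..1::real}) f" "f ` K \<subseteq> {1}"
    "f ` (topspace X - (U \<inter> W)) \<subseteq> {0}"
    using Urysohn_completely_regular_compact_closed[of 0 1 X K "topspace X - (U \<inter> W)"] K
    by (metis zero_le_one)
  have 01: "0 \<le> f x \<and> f x \<le> 1" if "x \<in> topspace X" for x
    using f(1) that by (auto simp: continuous_map_in_subtopology Pi_iff)
  have 0: "f x = 0" if "x \<in> topspace X" "x \<notin> U \<inter> W" for x
    using f(3) that by auto
  show thesis
  proof
    show "f \<in> C0_plus X"
      unfolding C0_plus_def
    proof (intro CollectI conjI allI impI)
      show "continuous_map X euclideanreal f" using f(1) by (simp add: continuous_map_in_subtopology)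
      fix e :: real assume "0 < e"
      then show "\<exists>K. compactin X K \<and> (\<forall>x\<in>topspace X - K. f x < e)"
        using W 0 by (intro exI[of _ L]) force
    qed (use 01 in auto)
  qed (use 01 0 f(2) in auto)
qed

text \<open>A cutoff function that is 1 on the part of \<open>K\<close> outside \<open>V\<close> and 0 outside \<open>U\<close> is cut at height 1/2.\<close>

lemma compact_split:
  assumes LC: "locally_compact_space X" and H: "Hausdorff_space X"
    and K: "compactin X K" and U: "openin X U" and V: "openin X V" and KUV: "K \<subseteq> U \<union> V"
  obtains K1 K2 where "compactin X K1" "compactin X K2" "K1 \<subseteq> U" "K2 \<subseteq> V" "K = K1 \<union> K2"
proof -
  have cK: "closedin X K" using compactin_imp_closedin[OF H K] .
  have KV: "compactin X (K - V)" "K - V \<subseteq> U"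
    using cK V KUV by (auto intro: closed_compactin[OF K])
  obtain f where f: "f \<in> C0_plus X" "\<And>x. x \<in> topspace X \<Longrightarrow> f x \<le> 1"
    "\<And>x. x \<in> K - V \<Longrightarrow> f x = 1" "\<And>x. x \<in> topspace X - U \<Longrightarrow> f x = 0"
    by (rule C0_plus_cutoff[OF LC H KV(1) U KV(2)]) (rule that)
  have "continuous_map X euclideanreal f" using f(1) by (simp add: C0_plus_def)
  from closedin_continuous_map_preimage[OF this, of "{1/2..}"]
    closedin_continuous_map_preimage[OF this, of "{..1/2}"]
  have cl: "closedin X (K \<inter> {x \<in> topspace X. 1/2 \<le> f x})" "closedin X (K \<inter> {x \<in> topspace X. f x \<le> 1/2})"
    using cK by auto
  show thesis
  proof
    show "compactin X (K \<inter> {x \<in> topspace X. 1/2 \<le> f x})" "compactin X (K \<inter> {x \<in> topspace X. f x \<le> 1/2})"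
      using cl by (auto intro: closed_compactin[OF K])
    show "K \<inter> {x \<in> topspace X. 1/2 \<le> f x} \<subseteq> U" using f(4) by force
    show "K \<inter> {x \<in> topspace X. f x \<le> 1/2} \<subseteq> V" using f(3) by force
    show "K = K \<inter> {x \<in> topspace X. 1/2 \<le> f x} \<union> K \<inter> {x \<in> topspace X. f x \<le> 1/2}"
      using closedin_subset[OF cK] by auto
  qed
qed

text \<open>A compact subset of \<open>U \<union> V\<close> is split into a part in \<open>U\<close> and a part in \<open>V\<close>. With cutoff functions
\<open>f\<close> and \<open>g\<close> for the parts, the maximum of \<open>f\<close> and \<open>g\<close> is 1 on the whole set, while the integrals of
\<open>f\<close> and \<open>g\<close> are at most \<open>\<nu> U\<close> and \<open>\<nu> V\<close>.\<close>

lemma subadditive_on_open_if_dtm_integral_max_le: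
  assumes LC: "locally_compact_space X" and H: "Hausdorff_space X" and \<nu>: "\<nu> \<in> DTM X"
    and le: "\<And>f g. f \<in> C0_plus X \<Longrightarrow> g \<in> C0_plus X \<Longrightarrow>
      dtm_integral X \<nu> (\<lambda>x. max (f x) (g x)) \<le> dtm_integral X \<nu> f + dtm_integral X \<nu> g"
  shows "subadditive_on_open X \<nu>"
  unfolding subadditive_on_open_def
proof (intro allI impI)
  fix U V assume U: "openin X U" and V: "openin X V"
  have "\<nu> K \<le> \<nu> U + \<nu> V" if K: "compactin X K" "K \<subseteq> U \<union> V" for K
  proof -
    obtain K1 K2 where K12: "compactin X K1" "compactin X K2" "K1 \<subseteq> U" "K2 \<subseteq> V" "K = K1 \<union> K2"
      using compact_split[OF LC H K(1) U V K(2)] by blast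
    obtain f where f: "f \<in> C0_plus X" "\<And>x. x \<in> topspace X \<Longrightarrow> f x \<le> 1" "\<And>x. x \<in> K1 \<Longrightarrow> f x = 1"
      "\<And>x. x \<in> topspace X - U \<Longrightarrow> f x = 0"
      using C0_plus_cutoff[OF LC H K12(1) U K12(3)] by blast
    obtain g where g: "g \<in> C0_plus X" "\<And>x. x \<in> topspace X \<Longrightarrow> g x \<le> 1" "\<And>x. x \<in> K2 \<Longrightarrow> g x = 1"
      "\<And>x. x \<in> topspace X - V \<Longrightarrow> g x = 0"
      using C0_plus_cutoff[OF LC H K12(2) V K12(4)] by blast
    have cK: "closedin X K" using compactin_imp_closedin[OF H K(1)] .
    have "enn2real (\<nu> K) \<le> dtm_integral X \<nu> (\<lambda>x. max (f x) (g x))"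
      using f(3) g(3) K12(5) by (intro dtm_integral_ge_closed[OF \<nu>] max_in_C0_plus f g cK) (force simp: le_max_iff_disj)
    also have "\<dots> \<le> dtm_integral X \<nu> f + dtm_integral X \<nu> g"
      by (intro le f g)
    also have "\<dots> \<le> enn2real (\<nu> U) + enn2real (\<nu> V)"
      by (intro add_mono dtm_integral_le_open[OF \<nu>] f g U V)
    finally have "ennreal (enn2real (\<nu> K)) \<le> ennreal (enn2real (\<nu> U) + enn2real (\<nu> V))"
      by (rule ennreal_leI)
    then show ?thesis
      using DTM_finite[OF \<nu>, of K] DTM_finite[OF \<nu>, of U] DTM_finite[OF \<nu>, of V] U V cK
      by (simp add: ennreal_plus)
  qed
  then show "\<nu> (U \<union> V) \<le> \<nu> U + \<nu> V"
    using U V by (subst DTM_open_eq_SUP[OF \<nu>]) (auto intro!: SUP_least)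
qed

section \<open>The set of measures in the weak topology\<close>

text \<open>Measures are cut out by the inequalities between the integrals of the maximum of \<open>f\<close> and \<open>g\<close> and
those of \<open>f\<close> and \<open>g\<close>. Each is a closed condition, because integrals of functions in \<open>C0_plus X\<close> are
continuous in the weak topology.\<close>

lemma closedin_Meas:
  assumes LC: "locally_compact_space X" and H: "Hausdorff_space X"
  shows "closedin (weak_topology X) (Meas X)"
proof -
  let ?D = "\<lambda>f g \<mu>. dtm_integral X \<mu> f + dtm_integral X \<mu> g - dtm_integral X \<mu> (\<lambda>x. max (f x) (g x))"
  let ?S = "\<lambda>(f, g). {\<mu> \<in> topspace (weak_topology X). ?D f g \<mu> \<in> {0..}}"
  have z: "(\<lambda>_. 0) \<in> C0_plus X"
    unfolding C0_plus_def by (auto intro: exI[of _ "{}"])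
  have "closedin (weak_topology X) (\<Inter>p\<in>C0_plus X \<times> C0_plus X. ?S p)"
  proof (rule closedin_INT)
    fix p assume "p \<in> C0_plus X \<times> C0_plus X"
    then obtain f g where p: "p = (f, g)" "f \<in> C0_plus X" "g \<in> C0_plus X" by auto
    then have "continuous_map (weak_topology X) euclideanreal (?D f g)"
      by (intro continuous_map_diff continuous_map_add continuous_map_weak_topology max_in_C0_plus)
    from closedin_continuous_map_preimage[OF this, of "{0..}"] p
    show "closedin (weak_topology X) (?S p)" by simp
  qed (use z in blast)
  moreover have "(\<Inter>p\<in>C0_plus X \<times> C0_plus X. ?S p) = Meas X"
  proof (intro equalityI subsetI)
    fix \<mu> assume \<mu>: "\<mu> \<in> (\<Inter>p\<in>C0_plus X \<times> C0_plus X. ?S p)"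
    then have D: "\<mu> \<in> DTM X" using z by auto
    have "dtm_integral X \<mu> (\<lambda>x. max (f x) (g x)) \<le> dtm_integral X \<mu> f + dtm_integral X \<mu> g"
      if "f \<in> C0_plus X" "g \<in> C0_plus X" for f g
      using INT_D[OF \<mu>, of "(f, g)"] that by simp
    with D show "\<mu> \<in> Meas X"
      using subadditive_on_open_if_dtm_integral_max_le[OF LC H D] by (simp add: Meas_iff_subadditive[OF H])
  next
    fix \<mu> assume "\<mu> \<in> Meas X"
    then show "\<mu> \<in> (\<Inter>p\<in>C0_plus X \<times> C0_plus X. ?S p)"
      using dtm_integral_max_le[of \<mu> X] by (auto simp: Meas_iff_subadditive[OF H])
  qed
  ultimately show ?thesis by simp
qed

lemma continuous_map_add_scaled:
  assumes H: "Hausdorff_space X" and \<mu>: "\<mu> \<in> DTM X" and \<nu>: "\<nu> \<in> DTM X"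
  shows "continuous_map (top_of_set {0..}) (weak_topology X) (\<lambda>c. add_scaled X \<mu> c \<nu>)"
  unfolding weak_topology_def
proof (rule continuous_on_generated_topo)
  let ?T = "top_of_set {0::real..}"
  show "openin ?T ((\<lambda>c. add_scaled X \<mu> c \<nu>) -` W \<inter> topspace ?T)"
    if "W \<in> {{\<mu> \<in> DTM X. dtm_integral X \<mu> f \<in> V} | f V. f \<in> C0_plus X \<and> open V}" for W
  proof -
    obtain f V where f: "f \<in> C0_plus X" and V: "open V"
      and W: "W = {\<mu> \<in> DTM X. dtm_integral X \<mu> f \<in> V}"
      using \<open>W \<in> _\<close> by auto
    let ?h = "\<lambda>c. dtm_integral X \<mu> f + c * dtm_integral X \<nu> f"
    have "(\<lambda>c. add_scaled X \<mu> c \<nu>) -` W \<inter> topspace ?T = {0..} \<inter> ?h -` V"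
      by (auto simp: W dtm_integral_add_scaled[OF \<mu> \<nu> _ f] add_scaled_in_DTM[OF H \<mu> \<nu>])
    moreover have "openin ?T ({0..} \<inter> ?h -` V)"
      using V by (intro continuous_openin_preimage_gen continuous_intros)
    ultimately show ?thesis by simp
  qed
  have "DTM X = topspace (weak_topology X)" by simp
  also have "\<dots> = \<Union>{{\<mu> \<in> DTM X. dtm_integral X \<mu> f \<in> V} | f V. f \<in> C0_plus X \<and> open V}"
    unfolding weak_topology_def by (rule topology_generated_by_topspace)
  finally show "(\<lambda>c. add_scaled X \<mu> c \<nu>) ` topspace ?T
      \<subseteq> \<Union>{{\<mu> \<in> DTM X. dtm_integral X \<mu> f \<in> V} | f V. f \<in> C0_plus X \<and> open V}"
    using add_scaled_in_DTM[OF H \<mu> \<nu>] by auto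
qed

text \<open>Since the set of measures is closed, only its interior matters. The set \<open>T\<close> stands for \<open>DTM X\<close> or
\<open>TM X\<close>. An interior point \<open>\<mu>\<close> would allow a move in the direction \<open>\<nu>\<close>, a non-measure: the combination
\<open>\<mu> + c \<nu>\<close> would still be a measure for small \<open>c > 0\<close>, and then so would \<open>\<nu>\<close>.\<close>

lemma nowhere_dense_Meas:
  assumes LC: "locally_compact_space X" and H: "Hausdorff_space X"
    and T: "T \<subseteq> DTM X" and MT: "Meas X \<subseteq> T"
    and cone: "\<And>\<mu> \<nu> c. \<mu> \<in> T \<Longrightarrow> \<nu> \<in> T \<Longrightarrow> 0 \<le> c \<Longrightarrow> add_scaled X \<mu> c \<nu> \<in> T"
    and \<nu>: "\<nu> \<in> T" and nM: "\<nu> \<notin> Meas X"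
  shows "nowhere_dense_in (subtopology (weak_topology X) T) (Meas X)"
proof -
  let ?Y = "subtopology (weak_topology X) T"
  have "closedin ?Y (Meas X)"
    using closedin_Meas[OF LC H] MT by (intro closedin_closed_subtopology[THEN iffD2, OF _] closedin_subset_topspace) auto
  then have cl: "?Y closure_of Meas X = Meas X" by (simp add: closure_of_closedin)
  have "?Y interior_of Meas X = {}"
  proof (rule equals0I)
    fix \<mu> assume "\<mu> \<in> ?Y interior_of Meas X"
    then obtain W where W: "openin ?Y W" "\<mu> \<in> W" "W \<subseteq> Meas X"
      by (auto simp: interior_of_def)
    then have \<mu>: "\<mu> \<in> Meas X" by auto
    have D: "\<mu> \<in> DTM X" "\<nu> \<in> DTM X" using \<mu> \<nu> T MT by auto
    let ?T = "top_of_set {0::real..}"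
    have "continuous_map ?T ?Y (\<lambda>c. add_scaled X \<mu> c \<nu>)"
      using continuous_map_add_scaled[OF H D] \<mu> \<nu> MT cone by (auto simp: continuous_map_in_subtopology)
    from openin_continuous_map_preimage[OF this W(1)]
    have "openin ?T {c \<in> {0..}. add_scaled X \<mu> c \<nu> \<in> W}" by simp
    moreover have "0 \<in> {c \<in> {0..}. add_scaled X \<mu> c \<nu> \<in> W}"
      using W(2) add_scaled_0[OF D(1)] by simp
    ultimately obtain e where e: "0 < e" "\<And>c. c \<in> {0..} \<Longrightarrow> dist c 0 < e \<Longrightarrow> add_scaled X \<mu> c \<nu> \<in> W"
      unfolding openin_euclidean_subtopology_iff by blast
    then have "add_scaled X \<mu> (e/2) \<nu> \<in> Meas X"
      using W(3) by (auto simp: dist_real_def)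
    from Meas_if_add_scaled_Meas[OF H \<mu> D(2) _ this] e(1) nM show False by simp
  qed
  with cl show ?thesis
    using MT T by (auto simp: nowhere_dense_in_def)
qed

text \<open>The whole space is not nowhere dense in itself, because it contains the zero measure.\<close>

lemma not_all_Meas_if_nowhere_dense:
  assumes H: "Hausdorff_space X" and T: "T \<subseteq> DTM X" and MT: "Meas X \<subseteq> T"
    and nd: "nowhere_dense_in (subtopology (weak_topology X) T) (Meas X)"
  shows "\<exists>\<nu>\<in>T. \<nu> \<notin> Meas X"
proof (rule ccontr)
  assume "\<not> ?thesis"
  then have "topspace (subtopology (weak_topology X) T) = Meas X"
    using T MT by auto
  with nd have "Meas X = {}"
    unfolding nowhere_dense_in_def by (metis closure_of_topspace interior_of_topspace)
  with zero_in_Meas[OF H] show False by auto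
qed

theorem theorem56:
  fixes X :: "'a topology"
  assumes "locally_compact_space X" and "Hausdorff_space X"
  shows "((nowhere_dense_in (weak_topology X) (Meas X) \<longleftrightarrow> (\<exists>\<nu> \<in> DTM X. \<nu> \<notin> Meas X)) \<and>
          ((\<exists>\<nu> \<in> DTM X. \<nu> \<notin> Meas X) \<longleftrightarrow> (\<exists>\<nu> \<in> DTM X. nonzero X \<nu> \<and> proper X \<nu>)))
       \<and> ((nowhere_dense_in (subtopology (weak_topology X) (TM X)) (Meas X) \<longleftrightarrow>
            (\<exists>\<mu> \<in> TM X. \<mu> \<notin> Meas X)) \<and>
          ((\<exists>\<mu> \<in> TM X. \<mu> \<notin> Meas X) \<longleftrightarrow> (\<exists>\<mu> \<in> TM X. nonzero X \<mu> \<and> proper X \<mu>)))"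
proof -
  note LC = assms(1) and H = assms(2)
  have T: "TM X \<subseteq> DTM X" by (auto simp: TM_iff)
  have M: "Meas X \<subseteq> TM X" by (rule Meas_subset_TM[OF H])
  have nowhere_dense_iff: "nowhere_dense_in (subtopology (weak_topology X) T) (Meas X)
      \<longleftrightarrow> (\<exists>\<nu>\<in>T. \<nu> \<notin> Meas X)"
    if "T \<subseteq> DTM X" "Meas X \<subseteq> T"
      "\<And>\<mu> \<nu> c. \<mu> \<in> T \<Longrightarrow> \<nu> \<in> T \<Longrightarrow> 0 \<le> c \<Longrightarrow> add_scaled X \<mu> c \<nu> \<in> T" for T
    using nowhere_dense_Meas[OF LC H that] not_all_Meas_if_nowhere_dense[OF H that(1,2)] by blast
  have proper_iff: "(\<exists>\<nu>\<in>T. \<nu> \<notin> Meas X) \<longleftrightarrow> (\<exists>\<nu>\<in>T. nonzero X \<nu> \<and> proper X \<nu>)"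
    if TD: "T \<subseteq> DTM X"
      and diff: "\<And>\<nu> m. \<nu> \<in> T \<Longrightarrow> m \<in> Meas X \<Longrightarrow> m \<le> \<nu> \<Longrightarrow> diff_on X \<nu> m \<in> T" for T
  proof
    assume "\<exists>\<nu>\<in>T. \<nu> \<notin> Meas X"
    then obtain \<nu> where \<nu>: "\<nu> \<in> T" "\<nu> \<notin> Meas X" by blast
    then have "\<nu> \<in> DTM X" using TD by blast
    from exists_nonzero_proper[OF H this \<nu>(2)] diff[OF \<nu>(1)]
    show "\<exists>\<nu>\<in>T. nonzero X \<nu> \<and> proper X \<nu>" by metis
  qed (use Meas_proper_imp_zero[OF H] in blast)
  have "nowhere_dense_in (weak_topology X) (Meas X) \<longleftrightarrow> (\<exists>\<nu>\<in>DTM X. \<nu> \<notin> Meas X)"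
    using nowhere_dense_iff[of "DTM X"] M T add_scaled_in_DTM[OF H]
      subtopology_topspace[of "weak_topology X"] by auto
  moreover have "(\<exists>\<nu>\<in>DTM X. \<nu> \<notin> Meas X) \<longleftrightarrow> (\<exists>\<nu>\<in>DTM X. nonzero X \<nu> \<and> proper X \<nu>)"
    by (intro proper_iff order_refl diff_on_in_DTM[OF H])
  moreover have "nowhere_dense_in (subtopology (weak_topology X) (TM X)) (Meas X)
      \<longleftrightarrow> (\<exists>\<mu>\<in>TM X. \<mu> \<notin> Meas X)"
    by (intro nowhere_dense_iff T M add_scaled_in_TM[OF H])
  moreover have "(\<exists>\<mu>\<in>TM X. \<mu> \<notin> Meas X) \<longleftrightarrow> (\<exists>\<mu>\<in>TM X. nonzero X \<mu> \<and> proper X \<mu>)"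
    using T by (intro proper_iff diff_on_in_TM[OF H]) auto
  ultimately show ?thesis by blast
qed

end
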